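(* Let $\sigma_1=x+y+z$, $\sigma_2=xy+yz+xz$, $\sigma_3=xyz$. The symmetric 3-algebraic 3-valued groups over $\mathbb{C}$ fall into exactly two classes. Precisely, let $P_3(z;x,y)$ be a polynomial and let $k_0$ denote the coefficient of $\sigma_3$ in the expression of $P_3(z;-x,-y)$ as a polynomial in $\sigma_1,\sigma_2,\sigma_3$. Then $P_3$ defines a symmetric 3-algebraic 3-valued group if and only if one of the following holds. (i) $k_0=-27$ and, for some $c\in\mathbb{C}$, $$P_3(z;-x,-y)=\sigma_1^3-27\sigma_3+18c\,\sigma_1^2\sigma_3-54c\,\sigma_2\sigma_3-27c^2\sigma_2^2\sigma_3+81c^2\sigma_1\sigma_3^2 .$$ The corresponding homogeneous 3-component is $P_3^{\mathrm h}(z;-x,-y)=\sigma_1^3-27\sigma_3$, which defines the 3-valued group $\mathbb{G}_3$. (ii) $k_0=0$ and, for some $\alpha\in\mathbb{C}$, $$P_3(z;-x,-y)=(\sigma_1+\alpha\sigma_3)^3 .$$ The corresponding homogeneous 3-component is $P_3^{\mathrm h}(z;-x,-y)=\sigma_1^3$. In this case the 3-valued group is obtained by the diagonal construction from the 1-algebraic 1-valued group defined by the polynomial $P_1(z;-x,-y)=\sigma_1+\alpha\sigma_3$, i.e. from $x\ast y=\frac{x+y}{1+\alpha xy}$; that is, the 3-valued product of $x$ and $y$ is this element repeated three times.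
   Context: An $n$-algebraic $n$-valued group on $\mathbb{C}$ is given by a polynomial $P(z;x,y)=\sum_{k=0}^n F_{n-k}(x,y)z^k$ with $F_{i}\in\mathbb{C}[x,y]$, of degree at most $n$ in each of $x,y,z$; the product of $x$ and $y$ (with $F_0(x,y)\ne0$) is the multiset $[z_1(x,y),\dots,z_n(x,y)]$ of roots of $P$ in $z$. It is required that: (a) $F_0(0,0)=1$; (b) (neutral element $0$) $P(z;0,y)=F_0(0,y)(z-y)^n$; (c) (inverse) there is an algebraic map $\mathrm{inv}:\mathbb{C}\to\mathbb{C}$ with $F_n(x,\mathrm{inv}(x))=F_n(\mathrm{inv}(x),x)=0$ for all $x$; (d) (associativity) $\prod_{j,k=1}^n\bigl(t-z_j(z_k(x,y),z)\bigr)=\prod_{j,k=1}^n\bigl(t-z_j(x,z_k(y,z))\bigr)$ identically in $t$, with $x,y,z$ independent variables. It is symmetric if $P(z;(-1)^nx,(-1)^ny)$ is symmetric in $x,y,z$. The homogeneous $n$-component $P^{\mathrm h}$ of $P$ is the sum of the terms of $P$ of total degree $n$ in $x,y,z$. The $n$-valued group $\mathbb{G}_n$ is $\mathbb{C}$ with $x\ast y=[(\sqrt[n]{x}+\epsilon^r\sqrt[n]{y})^n\mid r=1,\dots,n]$, where $\epsilon$ is a primitive $n$-th root of unity. *)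

theory Defs
  imports
    "HOL-Algebra.Algebraic_Closure_Type"
    "HOL-Computational_Algebra.Computational_Algebra"
begin

section \<open>Polynomials in three variables\<close>

text \<open>
  The ring $\mathbb{C}[x,y,z]$ is rendered as iterated univariate polynomials: the outermost
  variable is $z$, the middle one $y$ and the innermost one $x$. Hence a polynomial
  $P(z;x,y)$ is literally a polynomial in $z$ with coefficients in $\mathbb{C}[x,y]$.
\<close>

type_synonym poly2 = "complex poly poly"
type_synonym poly3 = "complex poly poly poly"

definition coeff3 :: "poly3 \<Rightarrow> nat \<Rightarrow> nat \<Rightarrow> nat \<Rightarrow> complex" where
  "coeff3 P i j k = Polynomial.coeff (Polynomial.coeff (Polynomial.coeff P k) j) i"

definition monom3 :: "complex \<Rightarrow> nat \<Rightarrow> nat \<Rightarrow> nat \<Rightarrow> poly3" where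
  "monom3 c i j k = Polynomial.monom (Polynomial.monom (Polynomial.monom c i) j) k"

definition const3 :: "complex \<Rightarrow> poly3" where
  "const3 c = [:[:[:c:]:]:]"

definition varx :: poly3 where "varx = [:[:[:0, 1:]:]:]"
definition vary :: poly3 where "vary = [:[:0, 1:]:]"
definition varz :: poly3 where "varz = [:0, 1:]"

text \<open>
  Evaluation in a commutative ring whose structure of a $\mathbb{C}$-algebra is given by the
  ring homomorphism \<open>h\<close>: \<open>zpoly h P x y\<close> is the univariate polynomial $P(\cdot;x,y)$.
  Note the argument order: \<open>eval3 h P x y z\<close> is $P(z;x,y)$.
\<close>

definition eval2 :: "(complex \<Rightarrow> 'a :: comm_ring_1) \<Rightarrow> poly2 \<Rightarrow> 'a \<Rightarrow> 'a \<Rightarrow> 'a" where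
  "eval2 h F x y = poly (map_poly (\<lambda>q. poly (map_poly h q) x) F) y"

definition zpoly :: "(complex \<Rightarrow> 'a :: comm_ring_1) \<Rightarrow> poly3 \<Rightarrow> 'a \<Rightarrow> 'a \<Rightarrow> 'a poly" where
  "zpoly h P x y = map_poly (\<lambda>F. eval2 h F x y) P"

definition eval3 :: "(complex \<Rightarrow> 'a :: comm_ring_1) \<Rightarrow> poly3 \<Rightarrow> 'a \<Rightarrow> 'a \<Rightarrow> 'a \<Rightarrow> 'a" where
  "eval3 h P x y z = poly (zpoly h P x y) z"

abbreviation subst3 :: "poly3 \<Rightarrow> poly3 \<Rightarrow> poly3 \<Rightarrow> poly3 \<Rightarrow> poly3" where
  "subst3 \<equiv> eval3 const3"

definition sigma1 :: poly3 where "sigma1 = varx + vary + varz"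
definition sigma2 :: poly3 where "sigma2 = varx * vary + vary * varz + varx * varz"
definition sigma3 :: poly3 where "sigma3 = varx * vary * varz"

text \<open>
  The coefficient of $\sigma_3$ in the expression of a symmetric polynomial \<open>R\<close> in terms of
  $\sigma_1,\sigma_2,\sigma_3$. The expression is unique when it exists; the value is
  unspecified if \<open>R\<close> is not symmetric.
\<close>

definition sigma3_coeff :: "poly3 \<Rightarrow> complex" where
  "sigma3_coeff R = coeff3 (THE Q. subst3 Q sigma1 sigma2 sigma3 = R) 0 0 1"

definition homogeneous_component :: "nat \<Rightarrow> poly3 \<Rightarrow> poly3" where
  "homogeneous_component n P =
     (\<Sum>(i, j, k) \<in> {(i, j, k). i + j + k = n}. monom3 (coeff3 P i j k) i j k)"


section \<open>Algebraic multivalued groups\<close>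

text \<open>The polynomial $F_i$ in $P(z;x,y)=\sum_{k=0}^n F_{n-k}(x,y)z^k$, for $0\le i\le n$.\<close>

definition Fcoeff :: "nat \<Rightarrow> poly3 \<Rightarrow> nat \<Rightarrow> poly2" where
  "Fcoeff n P i = Polynomial.coeff P (n - i)"

definition mult_prod ::
    "(complex \<Rightarrow> 'a :: idom) \<Rightarrow> poly3 \<Rightarrow> 'a \<Rightarrow> 'a \<Rightarrow> 'a multiset" where
  "mult_prod h P x y = proots (zpoly h P x y)"

text \<open>
  Associativity is required for independent variables $x,y,z$: these are taken in an algebraic
  closure of the field of rational functions $\mathbb{C}(x,y,z)$, which also contains all the
  iterated products.
\<close>

type_synonym generic = "poly3 fract alg_closure"

definition gen :: "poly3 \<Rightarrow> generic" where
  "gen R = to_ac (to_fract R)"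

definition gen_prod :: "poly3 \<Rightarrow> generic \<Rightarrow> generic \<Rightarrow> generic multiset" where
  "gen_prod P = mult_prod (\<lambda>c. gen (const3 c)) P"

definition generically_associative :: "poly3 \<Rightarrow> bool" where
  "generically_associative P \<longleftrightarrow>
     (\<Prod>w\<in>#gen_prod P (gen varx) (gen vary). \<Prod>v\<in>#gen_prod P w (gen varz). [:- v, 1:]) =
     (\<Prod>w\<in>#gen_prod P (gen vary) (gen varz). \<Prod>v\<in>#gen_prod P (gen varx) w. [:- v, 1:])"

text \<open>An algebraic map $\mathbb{C}\to\mathbb{C}$ is a morphism of the affine line, i.e. it is
  given by a polynomial.\<close>

definition algebraic_group :: "nat \<Rightarrow> poly3 \<Rightarrow> bool" where
  "algebraic_group n P \<longleftrightarrow>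
     (\<forall>i j k. coeff3 P i j k \<noteq> 0 \<longrightarrow> i \<le> n \<and> j \<le> n \<and> k \<le> n) \<and>
     eval2 id (Fcoeff n P 0) 0 0 = 1 \<and>
     subst3 P 0 vary varz = eval2 const3 (Fcoeff n P 0) 0 vary * (varz - vary) ^ n \<and>
     (\<exists>q :: complex poly. \<forall>x. eval2 id (Fcoeff n P n) x (poly q x) = 0 \<and>
                               eval2 id (Fcoeff n P n) (poly q x) x = 0) \<and>
     generically_associative P"

definition symmetric_poly3 :: "poly3 \<Rightarrow> bool" where
  "symmetric_poly3 R \<longleftrightarrow>
     (\<forall>a b c. {#a, b, c#} = {#varx, vary, varz#} \<longrightarrow> subst3 R a b c = R)"

definition symmetric_algebraic_group :: "nat \<Rightarrow> poly3 \<Rightarrow> bool" where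
  "symmetric_algebraic_group n P \<longleftrightarrow>
     algebraic_group n P \<and>
     symmetric_poly3 (subst3 P ((- 1) ^ n * varx) ((- 1) ^ n * vary) varz)"

definition primitive_root_of_unity :: "nat \<Rightarrow> complex \<Rightarrow> bool" where
  "primitive_root_of_unity n e \<longleftrightarrow>
     n > 0 \<and> e ^ n = 1 \<and> (\<forall>m. 0 < m \<and> m < n \<longrightarrow> e ^ m \<noteq> 1)"

text \<open>
  \<open>P\<close> defines the \<open>n\<close>-valued group $\mathbb{G}_n$: the product is everywhere defined and given
  by $[(\sqrt[n]{x}+\epsilon^r\sqrt[n]{y})^n \mid r=1,\dots,n]$, for every choice of the
  roots \<open>a\<close> of \<open>x\<close> and \<open>b\<close> of \<open>y\<close> and of the primitive root of unity.
\<close>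

definition defines_G :: "nat \<Rightarrow> poly3 \<Rightarrow> bool" where
  "defines_G n P \<longleftrightarrow>
     algebraic_group n P \<and>
     (\<forall>x y. eval2 id (Fcoeff n P 0) x y \<noteq> 0 \<and>
        (\<forall>a b e. a ^ n = x \<and> b ^ n = y \<and> primitive_root_of_unity n e \<longrightarrow>
           mult_prod id P x y = {#(a + e ^ r * b) ^ n. r \<in># mset_set {1..n}#}))"

text \<open>
  \<open>P\<close> defines the \<open>n * m\<close>-valued group obtained by the diagonal construction from the
  \<open>m\<close>-valued group defined by \<open>Q\<close>: every product is repeated \<open>n\<close> times.
\<close>

definition diagonal_of :: "nat \<Rightarrow> nat \<Rightarrow> poly3 \<Rightarrow> poly3 \<Rightarrow> bool" where
  "diagonal_of n m Q P \<longleftrightarrow>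
     (\<forall>x y. eval2 id (Fcoeff (n * m) P 0) x y \<noteq> 0 \<longleftrightarrow> eval2 id (Fcoeff m Q 0) x y \<noteq> 0) \<and>
     (\<forall>x y. eval2 id (Fcoeff m Q 0) x y \<noteq> 0 \<longrightarrow>
        mult_prod id P x y = repeat_mset n (mult_prod id Q x y))"

end

theory Submission
  imports Defs
begin

text \<open>
  Put \<open>R(x,y,z) = P(z;-x,-y)\<close>. The neutral element, the symmetry and the degree bound force
  \<open>R = \<sigma>\<^sub>1\<^sup>3 + \<sigma>\<^sub>3 S\<close> with ten free coefficients in \<open>S\<close>. Up to its leading coefficient in \<open>t\<close>, the
  polynomial whose roots form the iterated product of \<open>x\<close>, \<open>y\<close>, \<open>z\<close> is, after a change of signs, the
  resultant \<open>\<Phi>(x,y;z,t) = Res\<^sub>w(R(x,y,w), R(-w,z,t))\<close>. Since \<open>\<Phi>(x,y;z,0) = R(x,y,z)\<^sup>3\<close> is symmetric,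
  the leading coefficients of the two sides of associativity agree, and associativity says exactly that
  \<open>\<Phi>\<close> is invariant under \<open>x \<leftrightarrow> z\<close>.

  For the two families this is a polynomial identity. Conversely, the coefficient of \<open>s\<^sup>2\<close> in
  \<open>\<Phi>(x,s;s,t) - \<Phi>(x,t;s,s)\<close> is \<open>(x+t)\<^sup>3 (xt)\<^sup>2\<close> times a polynomial in \<open>x+t\<close> and \<open>xt\<close>, in which the
  coefficient of \<open>\<sigma>\<^sub>3\<^sup>2\<close> in \<open>S\<close> does not occur. Its vanishing determines the other nine coefficients up to
  one parameter, and comparing the leading coefficients of \<open>\<Phi>\<close> at \<open>(-T,T;T)\<close> and \<open>(T,T;-T)\<close> fixes the
  remaining one.
\<close>

section \<open>Ring morphisms and evaluation\<close>

text \<open>The same polynomial expressions are evaluated at complex numbers, at polynomials and at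
  generic elements. Every passage between these settings is an instance of this locale.\<close>

locale ring_morphism =
  fixes h :: "'a::comm_ring_1 \<Rightarrow> 'b::comm_ring_1"
  assumes zero [simp]: "h 0 = 0" and one [simp]: "h 1 = 1"
    and add [simp]: "h (a + b) = h a + h b" and mult [simp]: "h (a * b) = h a * h b"
begin

lemma uminus [simp]: "h (- a) = - h a"
  using add[of a "- a"] by (simp add: eq_neg_iff_add_eq_0 add.commute)

lemma diff [simp]: "h (a - b) = h a - h b"
  using add[of a "- b"] by simp

lemma power [simp]: "h (a ^ n) = h a ^ n"
  by (induction n) auto

lemma of_nat [simp]: "h (of_nat n) = of_nat n"
  by (induction n) auto

lemma numeral [simp]: "h (numeral n) = numeral n"
  using of_nat[of "numeral n"] by simp

lemma map_poly_add': "map_poly h (p + q) = map_poly h p + map_poly h q"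
  by (rule poly_eqI) (simp add: coeff_map_poly)

lemma map_poly_mult': "map_poly h (p * q) = map_poly h p * map_poly h q"
proof (induction p)
  case (pCons a p)
  have "map_poly h (Polynomial.smult a q) = Polynomial.smult (h a) (map_poly h q)"
    by (rule poly_eqI) (simp add: coeff_map_poly)
  with pCons show ?case
    by (simp add: map_poly_pCons map_poly_add')
qed simp

lemma ring_morphism_poly: "ring_morphism (\<lambda>p. poly (map_poly h p) x)"
  by unfold_locales (simp_all add: map_poly_add' map_poly_mult')

end

lemma ring_morphism_comp:
  assumes "ring_morphism g" "ring_morphism h"
  shows "ring_morphism (\<lambda>x. g (h x))"
proof -
  interpret g: ring_morphism g by fact
  interpret h: ring_morphism h by fact
  show ?thesis by unfold_locales auto
qed

lemma (in ring_morphism) poly_map_poly_comp: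
  "h (poly (map_poly f p) x) = poly (map_poly (\<lambda>c. h (f c)) p) (h x)" if "f 0 = 0"
  using that by (induction p) (simp_all add: map_poly_pCons)

lemma ring_morphism_const3 [simp]: "ring_morphism const3"
  by unfold_locales (simp_all add: const3_def one_pCons)

lemma ring_morphism_id [simp]: "ring_morphism (id :: 'a :: comm_ring_1 \<Rightarrow> 'a)"
  by unfold_locales auto

context
  fixes h :: "complex \<Rightarrow> 'a::comm_ring_1"
  assumes h: "ring_morphism h"
begin

interpretation h: ring_morphism h
  by (fact h)

lemma ring_morphism_eval2: "ring_morphism (\<lambda>F. eval2 h F x y)"
proof -
  interpret q: ring_morphism "\<lambda>q. poly (map_poly h q) x"
    by (rule h.ring_morphism_poly)
  show ?thesis
    unfolding eval2_def by (rule q.ring_morphism_poly)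
qed

lemma ring_morphism_eval3: "ring_morphism (\<lambda>P. eval3 h P x y z)"
proof -
  interpret F: ring_morphism "\<lambda>F. eval2 h F x y"
    by (rule ring_morphism_eval2)
  show ?thesis
    unfolding eval3_def zpoly_def by (rule F.ring_morphism_poly)
qed

lemma eval2_simps [simp]:
  "eval2 h [:[:c:]:] x y = h c" "eval2 h [:[:0, 1:]:] x y = x" "eval2 h [:0, 1:] x y = y"
  by (simp_all add: eval2_def map_poly_pCons)

lemma eval3_simps [simp]:
  "eval3 h (const3 c) x y z = h c" "eval3 h varx x y z = x" "eval3 h vary x y z = y"
  "eval3 h varz x y z = z"
  by (simp_all add: eval3_def zpoly_def eval2_def map_poly_pCons const3_def varx_def vary_def varz_def)

lemma eval3_0 [simp]: "eval3 h 0 x y z = 0"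
  and eval3_add [simp]: "eval3 h (P + Q) x y z = eval3 h P x y z + eval3 h Q x y z"
  and eval3_diff [simp]: "eval3 h (P - Q) x y z = eval3 h P x y z - eval3 h Q x y z"
  and eval3_uminus [simp]: "eval3 h (- P) x y z = - eval3 h P x y z"
  and eval3_mult [simp]: "eval3 h (P * Q) x y z = eval3 h P x y z * eval3 h Q x y z"
  and eval3_power [simp]: "eval3 h (P ^ n) x y z = eval3 h P x y z ^ n"
  and eval3_numeral [simp]: "eval3 h (numeral w) x y z = numeral w"
  and eval3_1 [simp]: "eval3 h 1 x y z = 1"
proof -
  interpret P: ring_morphism "\<lambda>P. eval3 h P x y z"
    by (rule ring_morphism_eval3)
  show "eval3 h 0 x y z = 0" "eval3 h (P + Q) x y z = eval3 h P x y z + eval3 h Q x y z"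
    "eval3 h (P - Q) x y z = eval3 h P x y z - eval3 h Q x y z"
    "eval3 h (- P) x y z = - eval3 h P x y z"
    "eval3 h (P * Q) x y z = eval3 h P x y z * eval3 h Q x y z"
    "eval3 h (P ^ n) x y z = eval3 h P x y z ^ n"
    "eval3 h (numeral w) x y z = numeral w" "eval3 h 1 x y z = 1"
    by (fact P.zero P.add P.diff P.uminus P.mult P.power P.numeral P.one)+
qed

lemma eval2_0 [simp]: "eval2 h 0 x y = 0"
  and eval2_add [simp]: "eval2 h (F + G) x y = eval2 h F x y + eval2 h G x y"
  and eval2_diff [simp]: "eval2 h (F - G) x y = eval2 h F x y - eval2 h G x y"
  and eval2_uminus [simp]: "eval2 h (- F) x y = - eval2 h F x y"
  and eval2_mult [simp]: "eval2 h (F * G) x y = eval2 h F x y * eval2 h G x y"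
  and eval2_power [simp]: "eval2 h (F ^ n) x y = eval2 h F x y ^ n"
  and eval2_numeral [simp]: "eval2 h (numeral w) x y = numeral w"
  and eval2_1 [simp]: "eval2 h 1 x y = 1"
proof -
  interpret F: ring_morphism "\<lambda>F. eval2 h F x y"
    by (rule ring_morphism_eval2)
  show "eval2 h 0 x y = 0" "eval2 h (F + G) x y = eval2 h F x y + eval2 h G x y"
    "eval2 h (F - G) x y = eval2 h F x y - eval2 h G x y"
    "eval2 h (- F) x y = - eval2 h F x y"
    "eval2 h (F * G) x y = eval2 h F x y * eval2 h G x y"
    "eval2 h (F ^ n) x y = eval2 h F x y ^ n"
    "eval2 h (numeral w) x y = numeral w" "eval2 h 1 x y = 1"
    by (fact F.zero F.add F.diff F.uminus F.mult F.power F.numeral F.one)+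
qed

lemma eval3_morphism:
  assumes "ring_morphism g"
  shows "g (eval3 h P x y z) = eval3 (\<lambda>c. g (h c)) P (g x) (g y) (g z)"
proof -
  interpret g: ring_morphism g by fact
  have "eval2 h 0 x y = 0" by simp
  then show ?thesis
    by (simp add: eval3_def zpoly_def eval2_def g.poly_map_poly_comp)
qed

end

lemma eval3_subst3 [simp]:
  "eval3 id (subst3 P u v w) a b c = eval3 id P (eval3 id u a b c) (eval3 id v a b c) (eval3 id w a b c)"
proof -
  have "(\<lambda>d. eval3 id (const3 d) a b c) = id"
    by (simp add: fun_eq_iff)
  with eval3_morphism[OF ring_morphism_const3 ring_morphism_eval3[OF ring_morphism_id], of P u v w a b c]
  show ?thesis by simp
qed

text \<open>Since the complex field is infinite, an identity in three variables can be checked on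
  values. The variables are stripped one at a time: z, then y, then x.\<close>

lemma poly3_eqI:
  assumes "\<And>a b c. eval3 id P a b c = eval3 id Q a b c"
  shows "P = Q"
proof (rule poly_eqI)
  fix k
  have zp: "zpoly id P a b = zpoly id Q a b" for a b
    by (rule poly_ext) (use assms in \<open>simp add: eval3_def\<close>)
  have c2: "poly (map_poly (\<lambda>q. poly q a) (Polynomial.coeff P k)) b =
      poly (map_poly (\<lambda>q. poly q a) (Polynomial.coeff Q k)) b" for a b
    using arg_cong[OF zp[of a b], of "\<lambda>p. Polynomial.coeff p k"]
    by (simp add: zpoly_def coeff_map_poly eval2_def map_poly_id)
  have c1: "map_poly (\<lambda>q. poly q a) (Polynomial.coeff P k) = map_poly (\<lambda>q. poly q a) (Polynomial.coeff Q k)" for a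
    using c2 by (rule poly_ext)
  show "Polynomial.coeff P k = Polynomial.coeff Q k"
  proof (rule poly_eqI)
    fix j
    have "poly (Polynomial.coeff (Polynomial.coeff P k) j) a =
        poly (Polynomial.coeff (Polynomial.coeff Q k) j) a" for a
      using arg_cong[OF c1[of a], of "\<lambda>p. Polynomial.coeff p j"]
      by (simp add: coeff_map_poly)
    then show "Polynomial.coeff (Polynomial.coeff P k) j = Polynomial.coeff (Polynomial.coeff Q k) j"
      by (rule poly_ext)
  qed
qed

interpretation gen: ring_morphism gen
  by unfold_locales (simp_all add: gen_def)

lemma gen_eq_iff [simp]: "gen p = gen q \<longleftrightarrow> p = q"
  by (simp add: gen_def)

lemma ring_morphism_gen_const3 [simp]: "ring_morphism (\<lambda>c. gen (const3 c))"
  by (rule ring_morphism_comp[OF gen.ring_morphism_axioms ring_morphism_const3])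

section \<open>Resultants of two cubics\<close>

text \<open>Bezout determinant; coefficients are listed from the constant term upwards.\<close>

definition cubic_resultant :: "'a::comm_ring_1 \<Rightarrow> 'a \<Rightarrow> 'a \<Rightarrow> 'a \<Rightarrow> 'a \<Rightarrow> 'a \<Rightarrow> 'a \<Rightarrow> 'a \<Rightarrow> 'a" where
  "cubic_resultant a0 a1 a2 a3 b0 b1 b2 b3 =
    (let d32 = a3 * b2 - a2 * b3; d31 = a3 * b1 - a1 * b3; d30 = a3 * b0 - a0 * b3;
         d21 = a2 * b1 - a1 * b2; d20 = a2 * b0 - a0 * b2; d10 = a1 * b0 - a0 * b1
     in d31 * (d31 * d10 - d20 * d30) + d30 * (d30 * (d30 + d21) - d31 * d20)
        - d32 * ((d30 + d21) * d10 - d20 ^ 2))"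

text \<open>This justifies the name: by Vieta, the first four arguments describe the cubic with
  leading coefficient a and roots u, v, w, and the determinant is the product of the values of the
  other cubic there.\<close>

lemma cubic_resultant_roots:
  fixes a :: "'a::idom"
  shows "cubic_resultant (- (a * u * v * w)) (a * (u * v + v * w + u * w)) (- (a * (u + v + w))) a b0 b1 b2 b3 =
    a ^ 3 * ((b0 + b1 * u + b2 * u ^ 2 + b3 * u ^ 3) * (b0 + b1 * v + b2 * v ^ 2 + b3 * v ^ 3) *
             (b0 + b1 * w + b2 * w ^ 2 + b3 * w ^ 3))"
  unfolding cubic_resultant_def Let_def by Groebner_Basis.algebra

text \<open>The second cubic is \<open>(z - w)^3\<close>, whose only root is z. This is the shape it
  takes when t is the neutral element.\<close>

lemma cubic_resultant_cube_linear:
  fixes z :: "'a::idom"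
  shows "cubic_resultant a0 a1 a2 a3 (z ^ 3) (- (3 * z ^ 2)) (3 * z) (- 1) =
      (a0 + a1 * z + a2 * z ^ 2 + a3 * z ^ 3) ^ 3"
  unfolding cubic_resultant_def Let_def by Groebner_Basis.algebra

text \<open>The cubics are \<open>(u + v w)^3\<close> and \<open>(u' + v' w)^3\<close>; the
  resultant of the two linear forms is counted once for each of the nine pairs of roots.\<close>

lemma cubic_resultant_cubes:
  fixes u v u' v' :: "'a::idom"
  shows "cubic_resultant (u ^ 3) (3 * u ^ 2 * v) (3 * u * v ^ 2) (v ^ 3) (u' ^ 3) (3 * u' ^ 2 * v')
      (3 * u' * v' ^ 2) (v' ^ 3) =
    (v * u' - u * v') ^ 9"
  unfolding cubic_resultant_def Let_def by Groebner_Basis.algebra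

lemma cubic_resultant_scale:
  fixes d e :: "'a::idom"
  shows "cubic_resultant (d * a0) (d * a1) (d * a2) (d * a3) (e * b0) (e * b1) (e * b2) (e * b3) =
    d ^ 3 * e ^ 3 * cubic_resultant a0 a1 a2 a3 b0 b1 b2 b3"
  unfolding cubic_resultant_def Let_def by Groebner_Basis.algebra

text \<open>The coefficients are those of \<open>\<Sum>i\<le>3. a\<^sub>i (k w - 1)\<^sup>i (k w + 1)\<^sup>3\<^sup>-\<^sup>i\<close>.\<close>

lemma cubic_resultant_mobius:
  fixes k :: "'a::idom"
  shows "cubic_resultant
      (a0 - a1 + a2 - a3) (k * (3 * a0 - a1 - a2 + 3 * a3))
      (k ^ 2 * (3 * a0 + a1 - a2 - 3 * a3)) (k ^ 3 * (a0 + a1 + a2 + a3))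
      (b0 - b1 + b2 - b3) (k * (3 * b0 - b1 - b2 + 3 * b3))
      (k ^ 2 * (3 * b0 + b1 - b2 - 3 * b3)) (k ^ 3 * (b0 + b1 + b2 + b3)) =
    (2 * k) ^ 9 * cubic_resultant a0 a1 a2 a3 b0 b1 b2 b3"
  unfolding cubic_resultant_def Let_def by Groebner_Basis.algebra

text \<open>The coefficients of the powers of \<open>z\<close> in \<open>\<sigma>\<^sub>1\<^sup>3 + \<sigma>\<^sub>3 S\<close>; the order of the coefficients of \<open>S\<close> is that of
    \<open>symmetric_cubic_sigma\<close>.\<close>

definition zcoeff0 :: "'a::comm_ring_1 \<Rightarrow> 'a \<Rightarrow> 'a" where
  "zcoeff0 x y = (x + y) ^ 3"
definition zcoeff1 :: "(nat \<Rightarrow> 'a::comm_ring_1) \<Rightarrow> 'a \<Rightarrow> 'a \<Rightarrow> 'a" where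
  "zcoeff1 k x y = 3 * (x + y) ^ 2 + x * y * (k 0 + k 1 * (x + y) + k 2 * (x * y) + k 4 * (x + y) ^ 2
     + k 5 * (x + y) * (x * y) + k 7 * (x * y) ^ 2)"
definition zcoeff2 :: "(nat \<Rightarrow> 'a::comm_ring_1) \<Rightarrow> 'a \<Rightarrow> 'a \<Rightarrow> 'a" where
  "zcoeff2 k x y = 3 * (x + y) + x * y * (k 1 + (k 2 + 2 * k 4) * (x + y) + k 3 * (x * y)
     + k 5 * (x * y + (x + y) ^ 2) + (k 6 + 2 * k 7) * (x + y) * (x * y) + k 8 * (x * y) ^ 2)"
definition zcoeff3 :: "(nat \<Rightarrow> 'a::comm_ring_1) \<Rightarrow> 'a \<Rightarrow> 'a \<Rightarrow> 'a" where
  "zcoeff3 k x y = 1 + x * y * (k 4 + k 5 * (x + y) + k 6 * (x * y) + k 7 * (x + y) ^ 2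
     + k 8 * (x * y) * (x + y) + k 9 * (x * y) ^ 2)"

lemmas zcoeff_defs = zcoeff0_def zcoeff1_def zcoeff2_def zcoeff3_def

definition symmetric_cubic :: "(nat \<Rightarrow> 'a::comm_ring_1) \<Rightarrow> 'a \<Rightarrow> 'a \<Rightarrow> 'a \<Rightarrow> 'a" where
  "symmetric_cubic k x y z = zcoeff0 x y + zcoeff1 k x y * z + zcoeff2 k x y * z ^ 2 + zcoeff3 k x y * z ^ 3"

lemma zcoeff_commute: "zcoeff0 y x = zcoeff0 x y" "zcoeff1 k y x = zcoeff1 k x y" "zcoeff2 k y x = zcoeff2 k x y"
    "zcoeff3 k y x = zcoeff3 k x y"
  by (simp_all add: zcoeff_defs add.commute mult.commute)

lemma symmetric_cubic_swap: "symmetric_cubic k x y z = symmetric_cubic k z y x"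
  by (simp add: symmetric_cubic_def zcoeff_defs algebra_simps power2_eq_square power3_eq_cube)

lemma symmetric_cubic_swap': "symmetric_cubic k x y z = symmetric_cubic k y x z"
  by (simp add: symmetric_cubic_def zcoeff_commute)

lemma symmetric_cubic_sigma:
  "symmetric_cubic k x y z = (let s = x + y + z; p = x * y + y * z + x * z; q = x * y * z in
     s ^ 3 + q * (k 0 + k 1 * s + k 2 * p + k 3 * q + k 4 * s ^ 2 + k 5 * s * p + k 6 * s * q
       + k 7 * p ^ 2 + k 8 * p * q + k 9 * q ^ 2))"
  by (simp add: symmetric_cubic_def zcoeff_defs Let_def algebra_simps power2_eq_square power3_eq_cube)

text \<open>The resultant of \<open>R(x,y,w)\<close> and \<open>R(-w,z,t)\<close> with respect to \<open>w\<close>.\<close>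

definition assoc_resultant :: "(nat \<Rightarrow> 'a::comm_ring_1) \<Rightarrow> 'a \<Rightarrow> 'a \<Rightarrow> 'a \<Rightarrow> 'a \<Rightarrow> 'a" where
  "assoc_resultant k x y z t = cubic_resultant (zcoeff0 x y) (zcoeff1 k x y) (zcoeff2 k x y) (zcoeff3 k x y)
                        (zcoeff0 z t) (- zcoeff1 k z t) (zcoeff2 k z t) (- zcoeff3 k z t)"

text \<open>Here \<open>R(-w,z,t)\<close> is replaced by its coefficient of \<open>t\<^sup>3\<close>, so this is the coefficient of \<open>t\<^sup>9\<close>.\<close>

definition assoc_lead :: "(nat \<Rightarrow> 'a::comm_ring_1) \<Rightarrow> 'a \<Rightarrow> 'a \<Rightarrow> 'a \<Rightarrow> 'a" where
  "assoc_lead k x y z = cubic_resultant (zcoeff0 x y) (zcoeff1 k x y) (zcoeff2 k x y) (zcoeff3 k x y)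
     1 (- (z * (k 4 + k 5 * z + k 7 * z ^ 2))) (z * (k 5 + (k 6 + 2 * k 7) * z + k 8 * z ^ 2))
     (- (z * (k 7 + k 8 * z + k 9 * z ^ 2)))"

text \<open>At t = 0 the second cubic \<open>R(-w,z,t)\<close> collapses to
  \<open>(z - w)^3\<close>.\<close>

lemma assoc_resultant_0: "assoc_resultant k x y (z :: 'a::idom) 0 = symmetric_cubic k x y z ^ 3"
  by (simp add: assoc_resultant_def symmetric_cubic_def cubic_resultant_cube_linear zcoeff0_def[of z] zcoeff1_def[of
      _ z] zcoeff2_def[of _ z] zcoeff3_def[of _ z])

section \<open>The low-order expansion of the resultant\<close>

lemma coeff_mult_upto_2:
  fixes p q :: "'a::comm_ring_1 poly"
  shows "Polynomial.coeff (p * q) 0 = Polynomial.coeff p 0 * Polynomial.coeff q 0"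
    "Polynomial.coeff (p * q) 1 = Polynomial.coeff p 0 * Polynomial.coeff q 1
        + Polynomial.coeff p 1 * Polynomial.coeff q 0"
    "Polynomial.coeff (p * q) 2 = Polynomial.coeff p 0 * Polynomial.coeff q 2
        + Polynomial.coeff p 1 * Polynomial.coeff q 1 + Polynomial.coeff p 2 * Polynomial.coeff q 0"
  by (simp_all add: coeff_mult numeral_2_eq_2)

lemma coeff_basic:
  fixes a :: "'a::comm_ring_1"
  shows "Polynomial.coeff [:a:] 0 = a" "Polynomial.coeff [:a:] 1 = 0" "Polynomial.coeff [:a:] 2 = 0"
    "Polynomial.coeff [:0, 1::'a:] 0 = 0" "Polynomial.coeff [:0, 1::'a:] 1 = 1"
        "Polynomial.coeff [:0, 1::'a:] 2 = 0"
    "Polynomial.coeff (1 :: 'a poly) 0 = 1" "Polynomial.coeff (1 :: 'a poly) 1 = 0"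
        "Polynomial.coeff (1 :: 'a poly) 2 = 0"
    "Polynomial.coeff (numeral n :: 'a poly) 0 = numeral n" "Polynomial.coeff (numeral n :: 'a poly) 1 = 0"
        "Polynomial.coeff (numeral n :: 'a poly) 2 = 0"
  by (simp_all add: numeral_poly numeral_2_eq_2)

lemmas coeff_rules = coeff_mult_upto_2 coeff_basic coeff_add coeff_diff coeff_minus power2_eq_square power3_eq_cube
  mult_zero_left mult_zero_right add_0 add_0_right mult_1 mult_1_right diff_0 diff_0_right minus_zero

lemma nth_10:
  "[k0, k1, k2, k3, k4, k5, k6, k7, k8, k9] ! 0 = k0" "[k0, k1, k2, k3, k4, k5, k6, k7, k8, k9] ! 1 = k1"
  "[k0, k1, k2, k3, k4, k5, k6, k7, k8, k9] ! 2 = k2" "[k0, k1, k2, k3, k4, k5, k6, k7, k8, k9] ! 3 = k3"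
  "[k0, k1, k2, k3, k4, k5, k6, k7, k8, k9] ! 4 = k4" "[k0, k1, k2, k3, k4, k5, k6, k7, k8, k9] ! 5 = k5"
  "[k0, k1, k2, k3, k4, k5, k6, k7, k8, k9] ! 6 = k6" "[k0, k1, k2, k3, k4, k5, k6, k7, k8, k9] ! 7 = k7"
  "[k0, k1, k2, k3, k4, k5, k6, k7, k8, k9] ! 8 = k8" "[k0, k1, k2, k3, k4, k5, k6, k7, k8, k9] ! 9 = k9"
  by simp_all

text \<open>The outer variable stands for \<open>x + t\<close>, the inner one for \<open>x t\<close>.\<close>

definition jet_poly :: "'a::comm_ring_1 \<Rightarrow> 'a \<Rightarrow> 'a \<Rightarrow> 'a \<Rightarrow> 'a \<Rightarrow> 'a \<Rightarrow> 'a \<Rightarrow> 'a \<Rightarrow> 'a \<Rightarrow> 'a poly poly" where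
  "jet_poly k0 k1 k2 k3 k4 k5 k6 k7 k8 =
    [:[:- (27 * k0 ^ 2 + k0 ^ 3), - (54 * k0 * k2 + 2 * k0 ^ 2 * k2),
        - (54 * k0 * k7 + 27 * k2 ^ 2 + k0 * k2 ^ 2 + 2 * k0 ^ 2 * k7),
        - (54 * k2 * k7 + 2 * k0 * k2 * k7), - (27 * k7 ^ 2 + k0 * k7 ^ 2):],
      [:- (18 * k0 * k1 + 2 * k0 ^ 2 * k1),
        - (18 * k0 * k5 + 18 * k1 * k2 + 2 * k0 * k1 * k2 + 2 * k0 ^ 2 * k5),
        - (18 * k1 * k7 + 18 * k2 * k5 + 2 * k0 * k1 * k7 + 2 * k0 * k2 * k5),
        - (18 * k5 * k7 + 2 * k0 * k5 * k7):],
      [:18 * k0 * k2 - 3 * k1 ^ 2 - k0 * k1 ^ 2 - 2 * k0 ^ 2 * k4,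
        48 * k0 * k7 - 6 * k1 * k5 + 6 * k2 ^ 2 - 2 * k0 * k1 * k5 - 2 * k0 * k2 * k4,
        18 * k2 * k7 - 3 * k5 ^ 2 - 2 * k0 * k4 * k7 - k0 * k5 ^ 2:],
      [:- 6 * k3 + 2 * k0 * k3 + 12 * k0 * k5 + 4 * k1 * k2 + 2 * k1 * k4 - 2 * k0 * k1 * k4,
        - 6 * k8 + 2 * k0 * k8 + 8 * k1 * k7 + 6 * k2 * k5 + 2 * k4 * k5 - 2 * k0 * k4 * k5:],
      [:- 6 * k6 - 3 * k7 + 2 * k0 * k6 - 5 * k0 * k7 + 3 * k1 * k5 + k2 * k4 + 2 * k4 ^ 2 - k0 * k4 ^ 2:]:]"

text \<open>\<open>[:0, 1:]\<close> is the variable s. Full symmetry of the resultant in its four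
  arguments makes the left side zero, so this identity turns associativity into equations for k0,
  ..., k8.\<close>

lemma assoc_resultant_jet:
  fixes k0 k1 k2 k3 k4 k5 k6 k7 k8 k9 x t :: "'a::idom"
  defines "k \<equiv> \<lambda>i. [:[k0, k1, k2, k3, k4, k5, k6, k7, k8, k9] ! i:]"
  shows "Polynomial.coeff (assoc_resultant k [:x:] [:0, 1:] [:0,
      1:] [:t:]) 2 - Polynomial.coeff (assoc_resultant k [:x:] [:t:] [:0, 1:] [:0, 1:]) 2 =
    (x + t) ^ 3 * (x * t) ^ 2 * poly (poly (jet_poly k0 k1 k2 k3 k4 k5 k6 k7 k8) [:x + t:]) (x * t)"
    unfolding assoc_resultant_def cubic_resultant_def Let_def zcoeff_defs k_def nth_10 jet_poly_def
    \<comment> \<open>Applying only the rules for the coefficients of degree at most two truncates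
      all products in s before the remaining identity in x and t is checked.\<close>
    by (simp only: coeff_rules poly_pCons poly_0 poly_add poly_mult) Groebner_Basis.algebra

section \<open>Associativity as symmetry of a resultant\<close>

text \<open>This is P recovered from R: both x and y enter with a minus sign. Listing the
  coefficients in z lets \<open>zpoly\<close> act on them separately.\<close>

definition symmetric_cubic_poly :: "(nat \<Rightarrow> complex) \<Rightarrow> poly3" where
  "symmetric_cubic_poly k = (let x = - [:[:0, 1:]:]; y = - [:0, 1:]; k' = \<lambda>i. [:[:k i:]:]
             in [:zcoeff0 x y, zcoeff1 k' x y, zcoeff2 k' x y, zcoeff3 k' x y:])"

context ring_morphism
begin

lemma morphism_zcoeff:
  "h (zcoeff0 x y) = zcoeff0 (h x) (h y)" "h (zcoeff1 k x y) = zcoeff1 (\<lambda>i. h (k i)) (h x) (h y)"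
  "h (zcoeff2 k x y) = zcoeff2 (\<lambda>i. h (k i)) (h x) (h y)" "h (zcoeff3 k x y) = zcoeff3 (\<lambda>i. h (k i)) (h x) (h y)"
  by (simp_all add: zcoeff_defs)

lemma morphism_assoc_resultant: "h (assoc_resultant k x y z t) =
    assoc_resultant (\<lambda>i. h (k i)) (h x) (h y) (h z) (h t)"
  by (simp add: assoc_resultant_def cubic_resultant_def Let_def morphism_zcoeff)

lemma morphism_assoc_lead: "h (assoc_lead k x y z) = assoc_lead (\<lambda>i. h (k i)) (h x) (h y) (h z)"
  by (simp add: assoc_lead_def cubic_resultant_def Let_def morphism_zcoeff)

lemma morphism_symmetric_cubic: "h (symmetric_cubic k x y z) = symmetric_cubic (\<lambda>i. h (k i)) (h x) (h y) (h z)"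
  by (simp add: symmetric_cubic_def morphism_zcoeff)

end

lemma zpoly_symmetric_cubic_poly:
  assumes h: "ring_morphism h"
  shows "zpoly h (symmetric_cubic_poly k) x y =
    [:zcoeff0 (- x) (- y), zcoeff1 (\<lambda>i. h (k i)) (- x) (- y), zcoeff2 (\<lambda>i. h (k i)) (- x) (- y),
        zcoeff3 (\<lambda>i. h (k i)) (- x) (- y):]"
proof -
  interpret F: ring_morphism "\<lambda>F. eval2 h F x y"
    by (rule ring_morphism_eval2[OF h])
  show ?thesis
    using h by (simp add: zpoly_def symmetric_cubic_poly_def Let_def map_poly_pCons F.morphism_zcoeff del:
        minus_pCons)
qed

lemma eval3_symmetric_cubic_poly:
  assumes "ring_morphism h"
  shows "eval3 h (symmetric_cubic_poly k) x y z = symmetric_cubic (\<lambda>i. h (k i)) (- x) (- y) z"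
  by (simp add: eval3_def zpoly_symmetric_cubic_poly[OF assms] symmetric_cubic_def algebra_simps power2_eq_square
      power3_eq_cube)

section \<open>Factorization over an algebraically closed field\<close>

lemma proots_prod_linear_factors: "proots (\<Prod>x\<in>#A. [:- x, 1:]) = (A :: 'a::idom multiset)"
  and degree_prod_linear_factors: "degree (\<Prod>x\<in>#A. [:- x, 1:]) = size A"
proof -
  have nz: "(\<Prod>x\<in>#A. [:- x, 1:]) \<noteq> 0" for A :: "'a multiset"
    by (auto simp: prod_mset_zero_iff)
  show "proots (\<Prod>x\<in>#A. [:- x, 1:]) = A"
    by (induction A) (simp_all add: proots_mult nz del: mult_pCons_left prod_mset_zero_iff)
  show "degree (\<Prod>x\<in>#A. [:- x, 1:]) = size A"
    by (induction A) (simp_all add: degree_mult_eq nz del: mult_pCons_left prod_mset_zero_iff)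
qed

lemma proots_splits:
  fixes p :: "'a::alg_closed_field poly"
  shows "p = Polynomial.smult (lead_coeff p) (\<Prod>x\<in>#proots p. [:- x, 1:])"
proof (cases "p = 0")
  case False
  then obtain A where A: "p = Polynomial.smult (lead_coeff p) (\<Prod>x\<in>#A. [:- x, 1:])"
    using alg_closed_imp_factorization[OF False] by auto
  with A False have "proots p = A"
    by (metis leading_coeff_0_iff proots_smult proots_prod_linear_factors)
  with A show ?thesis by simp
qed simp

lemma size_3_imp_triple: "\<exists>u v w. A = {#u, v, w#}" if "size A = 3"
proof -
  from that obtain u B where B: "A = add_mset u B" "size B = 2"
    using size_eq_Suc_imp_eq_union[of A 2] by fastforce
  from B(2) obtain v C where C: "B = add_mset v C" "size C = 1"
    using size_eq_Suc_imp_eq_union[of B 1] by fastforce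
  from C(2) obtain w where "C = {#w#}"
    using size_1_singleton_mset by blast
  with B C show ?thesis by blast
qed

lemma cubic_splits:
  fixes a3 :: "'a::alg_closed_field"
  assumes "a3 \<noteq> 0"
  obtains u v w where "proots [:a0, a1, a2, a3:] = {#u, v, w#}"
    "a0 = - (a3 * u * v * w)" "a1 = a3 * (u * v + v * w + u * w)" "a2 = - (a3 * (u + v + w))"
proof -
  let ?p = "[:a0, a1, a2, a3:]"
  have sp: "?p = Polynomial.smult a3 (\<Prod>x\<in>#proots ?p. [:- x, 1:])"
    using proots_splits[of ?p] assms by simp
  have "size (proots ?p) = degree (\<Prod>x\<in>#proots ?p. [:- x, 1:])"
    by (simp add: degree_prod_linear_factors)
  also have "\<dots> = degree ?p"
    by (subst (2) sp) (use assms in simp)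
  finally have "size (proots ?p) = 3"
    using assms by simp
  then obtain u v w where uvw: "proots ?p = {#u, v, w#}"
    using size_3_imp_triple by blast
  have "?p = Polynomial.smult a3 ([:- u, 1:] * [:- v, 1:] * [:- w, 1:])"
    using sp by (simp only: uvw image_mset_add_mset image_mset_empty prod_mset.add_mset prod_mset.empty mult_1_left
        mult_1_right mult_ac)
  also have "[:- u, 1:] * [:- v, 1:] * [:- w, 1:] = [:- (u * v * w), u * v + v * w + u * w, - (u + v + w), 1:]"
    by (simp add: algebra_simps)
  finally show thesis
    by (intro that[OF uvw]) (auto simp: algebra_simps)
qed

text \<open>Vieta's formulas bring an arbitrary cubic into the form of
  \<open>cubic_resultant_roots\<close>; the multiset of roots accounts for multiplicities.\<close>

lemma cubic_resultant_proots:
  fixes a3 :: "'a::alg_closed_field"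
  assumes "a3 \<noteq> 0"
  shows "a3 ^ 3 * (\<Prod>w\<in>#proots [:a0, a1, a2, a3:]. b0 + b1 * w + b2 * w ^ 2 + b3 * w ^ 3) =
    cubic_resultant a0 a1 a2 a3 b0 b1 b2 b3"
proof -
  obtain u v w where uvw: "proots [:a0, a1, a2, a3:] = {#u, v, w#}"
    "a0 = - (a3 * u * v * w)" "a1 = a3 * (u * v + v * w + u * w)" "a2 = - (a3 * (u + v + w))"
    using cubic_splits[OF assms] .
  have "cubic_resultant a0 a1 a2 a3 b0 b1 b2 b3 = a3 ^ 3 * ((b0 + b1 * u + b2 * u ^ 2 + b3 * u ^ 3) * (b0 + b1 * v
      + b2 * v ^ 2 + b3 * v ^ 3) *
            (b0 + b1 * w + b2 * w ^ 2 + b3 * w ^ 3))"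
    unfolding uvw(2-) by (rule cubic_resultant_roots)
  then show ?thesis
    by (simp add: uvw(1) mult.assoc)
qed

section \<open>The iterated product as a resultant\<close>

definition iterated :: "poly3 \<Rightarrow> generic \<Rightarrow> generic \<Rightarrow> generic \<Rightarrow> generic poly" where
  "iterated P x y z = (\<Prod>w\<in>#gen_prod P x y. \<Prod>v\<in>#gen_prod P w z. [:- v, 1:])"

lemma iterated_monic: "lead_coeff (iterated P x y z) = 1"
proof -
  have "lead_coeff (\<Prod>w\<in>#A. f w) = 1" if "\<And>w. lead_coeff (f w) = 1" for A and f :: "generic \<Rightarrow> generic poly"
    by (induction A) (simp_all add: lead_coeff_mult that)
  then show ?thesis
    by (simp add: iterated_def)
qed

lemma gen_prod_symmetric_cubic_poly:
  "gen_prod (symmetric_cubic_poly k) x y = (let k' = \<lambda>i. gen (const3 (k i)) in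
     proots [:zcoeff0 (- x) (- y), zcoeff1 k' (- x) (- y), zcoeff2 k' (- x) (- y), zcoeff3 k' (- x) (- y):])"
  by (simp add: gen_prod_def mult_prod_def zpoly_symmetric_cubic_poly Let_def)

lemma gen_prod_symmetric_cubic_poly_commute: "gen_prod (symmetric_cubic_poly k) x y =
    gen_prod (symmetric_cubic_poly k) y x"
  unfolding gen_prod_symmetric_cubic_poly Let_def zcoeff_commute(1)[of "- x" "- y"] zcoeff_commute(2-4)[of _ "- x"
      "- y"] ..

text \<open>The product is commutative, so the bracketing with y and z first is the other bracketing
  with the three variables rotated.\<close>

lemma generically_associative_symmetric_cubic_poly_iff_iterated:
  "generically_associative (symmetric_cubic_poly k) \<longleftrightarrow>
     iterated (symmetric_cubic_poly k) (gen varx) (gen vary) (gen varz) =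
         iterated (symmetric_cubic_poly k) (gen vary) (gen varz) (gen varx)"
  unfolding generically_associative_def iterated_def
  by (subst (4) gen_prod_symmetric_cubic_poly_commute) (rule refl)

text \<open>For each root w of \<open>R(-x,-y,w)\<close>, the inner monic product times its leading
  coefficient is \<open>R(-w,-z,t)\<close>. Multiplying over all w gives the resultant on one side,
  and on the other side collects the leading coefficients into \<open>assoc_lead\<close>.\<close>

lemma iterated_symmetric_cubic_poly:
  fixes k :: "nat \<Rightarrow> complex" and x y z t :: generic
  defines "k' \<equiv> \<lambda>i. gen (const3 (k i))"
  assumes nz: "zcoeff3 k' (- x) (- y) \<noteq> 0" "assoc_lead k' (- x) (- y) (- z) \<noteq> 0"
  shows "poly (iterated (symmetric_cubic_poly k) x y z) t * assoc_lead k' (- x) (- y) (- z) =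
      assoc_resultant k' (- x) (- y) (- z) t"
proof -
  let ?W = "gen_prod (symmetric_cubic_poly k) x y"
  have W: "?W = proots [:zcoeff0 (- x) (- y), zcoeff1 k' (- x) (- y), zcoeff2 k' (- x) (- y), zcoeff3 k' (- x)
      (- y):]"
    by (simp add: gen_prod_symmetric_cubic_poly k'_def Let_def)
  have assoc_lead: "assoc_lead k' (- x) (- y) (- z) = zcoeff3 k' (- x) (- y) ^ 3 * (\<Prod>w\<in>#?W. zcoeff3 k' (- w) (- z))"
    unfolding assoc_lead_def W cubic_resultant_proots[OF nz(1), symmetric]
    by (intro arg_cong2[where f = "(*)"] arg_cong[where f = prod_mset] image_mset_cong refl)
       (simp add: zcoeff3_def algebra_simps power2_eq_square power3_eq_cube)
  have assoc_resultant: "assoc_resultant k' (- x) (- y) (- z) t =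
      zcoeff3 k' (- x) (- y) ^ 3 * (\<Prod>w\<in>#?W. symmetric_cubic k' (- w) (- z) t)"
  proof -
    \<comment> \<open>By symmetry \<open>R(-w,-z,t)\<close> may be read as a cubic in w; the sign of
      w accounts for the alternating signs in \<open>assoc_resultant\<close>.\<close>
    have "symmetric_cubic k' (- w) (- z) t = zcoeff0 (- z) t + - zcoeff1 k' (- z) t * w + zcoeff2 k' (- z) t * w ^ 2
        + - zcoeff3 k' (- z) t * w ^ 3" for w
      unfolding symmetric_cubic_swap[of k' "- w"] symmetric_cubic_swap'[of k' t]
      by (simp add: symmetric_cubic_def power2_eq_square power3_eq_cube)
    then show ?thesis
      by (simp only: assoc_resultant_def W cubic_resultant_proots[OF nz(1)])
  qed
  have "poly (\<Prod>v\<in>#gen_prod (symmetric_cubic_poly k) w z. [:- v, 1:]) t * zcoeff3 k' (- w) (- z) =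
      symmetric_cubic k' (- w) (- z) t"
    if "w \<in># ?W" for w
  proof -
    \<comment> \<open>This leading coefficient is one of the factors of the nonzero
      \<open>assoc_lead\<close>, so the inner polynomial has exact degree three.\<close>
    have "zcoeff3 k' (- w) (- z) \<noteq> 0"
      using nz(2) that by (auto simp: assoc_lead prod_mset_zero_iff)
    moreover have "zpoly (\<lambda>c. gen (const3 c)) (symmetric_cubic_poly k) w z =
        [:zcoeff0 (- w) (- z), zcoeff1 k' (- w) (- z), zcoeff2 k' (- w) (- z), zcoeff3 k' (- w) (- z):]"
      by (simp add: zpoly_symmetric_cubic_poly k'_def)
    ultimately have "zpoly (\<lambda>c. gen (const3 c)) (symmetric_cubic_poly k) w z =
        Polynomial.smult (zcoeff3 k' (- w) (- z)) (\<Prod>v\<in>#gen_prod (symmetric_cubic_poly k) w z. [:- v, 1:])"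
      using proots_splits[of "zpoly (\<lambda>c. gen (const3 c)) (symmetric_cubic_poly k) w z"]
      by (simp add: gen_prod_def mult_prod_def)
    then have "poly (zpoly (\<lambda>c. gen (const3 c)) (symmetric_cubic_poly k) w z) t =
        zcoeff3 k' (- w) (- z) * poly (\<Prod>v\<in>#gen_prod (symmetric_cubic_poly k) w z. [:- v, 1:]) t"
      by simp
    moreover have "poly (zpoly (\<lambda>c. gen (const3 c)) (symmetric_cubic_poly k) w z) t =
        symmetric_cubic k' (- w) (- z) t"
      using eval3_symmetric_cubic_poly[OF ring_morphism_gen_const3, of k w z t] by (simp add: eval3_def k'_def)
    ultimately show ?thesis
      by (simp add: mult.commute)
  qed
  then have "(\<Prod>w\<in>#?W. poly (\<Prod>v\<in>#gen_prod (symmetric_cubic_poly k) w z. [:- v, 1:]) t * zcoeff3 k' (- w) (- z)) =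
      (\<Prod>w\<in>#?W. symmetric_cubic k' (- w) (- z) t)"
    by (intro arg_cong[where f = prod_mset] image_mset_cong)
  then show ?thesis
    unfolding assoc_resultant assoc_lead iterated_def
    by (simp add: prod_mset.distrib poly_prod_mset image_mset.compositionality o_def mult_ac)
qed

section \<open>The two coefficient families and their resultants\<close>

definition elliptic_coeffs :: "'a::comm_ring_1 \<Rightarrow> nat \<Rightarrow> 'a" where
  "elliptic_coeffs c i = [- 27, 0, - (54 * c), 0, 18 * c, 0, 81 * c ^ 2, - (27 * c ^ 2), 0, 0] ! i"

definition cube_coeffs :: "'a::comm_ring_1 \<Rightarrow> nat \<Rightarrow> 'a" where
  "cube_coeffs c i = [0, 0, 0, 0, 3 * c, 0, 3 * c ^ 2, 0, 0, c ^ 3] ! i"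

lemma elliptic_coeffs_simps: "elliptic_coeffs c 0 = - 27" "elliptic_coeffs c 1 = 0"
    "elliptic_coeffs c 2 = - (54 * c)" "elliptic_coeffs c 3 = 0"
  "elliptic_coeffs c 4 = 18 * c" "elliptic_coeffs c 5 = 0" "elliptic_coeffs c 6 = 81 * c ^ 2"
      "elliptic_coeffs c 7 = - (27 * c ^ 2)"
  "elliptic_coeffs c 8 = 0" "elliptic_coeffs c 9 = 0"
  by (simp_all add: elliptic_coeffs_def)

lemma cube_coeffs_simps: "cube_coeffs c 0 = 0" "cube_coeffs c 1 = 0" "cube_coeffs c 2 = 0" "cube_coeffs c 3 = 0"
  "cube_coeffs c 4 = 3 * c" "cube_coeffs c 5 = 0" "cube_coeffs c 6 = 3 * c ^ 2" "cube_coeffs c 7 = 0"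
  "cube_coeffs c 8 = 0" "cube_coeffs c 9 = c ^ 3"
  by (simp_all add: cube_coeffs_def)

text \<open>The coefficient of \<open>\<sigma>\<^sub>3\<^sup>2\<close> in S is left free as q. The
  points are chosen with x + y = 0 on one side, where \<open>zcoeff0\<close> vanishes. The lowest
  term is \<open>504 q T^6\<close>, so a vanishing defect forces q = 0.\<close>

lemma assoc_lead_elliptic_coeffs_defect:
  fixes c q T :: "'a::idom"
  shows "assoc_lead ((elliptic_coeffs c)(9 := q)) (- T) T T - assoc_lead ((elliptic_coeffs c)(9 := q)) T T (- T) =
    poly [:0, 0, 0, 0, 0, 0, 504 * q, 0, - 7452 * c * q, 0, - 343602 * c ^ 2 * q, 0, - 34992 * c ^ 3 * q
        + 21024 * q ^ 2, 0, - 65448 * c * q ^ 2 + 1482786 * c ^ 4 * q, 0,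
        178848 * c ^ 2 * q ^ 2 - 12045996 * c ^ 5 * q, 0, - 262440 * c ^ 3 * q ^ 2 + 23422770 * c ^ 6 * q
        + 342 * q ^ 3, 0, 104976 * c ^ 4 * q ^ 2 - 15588936 * c ^ 7 * q, 0, 3188646 * c ^ 8 * q:] T"
  by (simp only: assoc_lead_def cubic_resultant_def Let_def zcoeff_defs elliptic_coeffs_simps fun_upd_apply
      poly_pCons poly_0 num.distinct num.inject numeral_eq_iff one_eq_numeral_iff zero_neq_numeral
      numeral_eq_one_iff if_True if_False simp_thms mult_zero_left mult_zero_right add_0_left add_0_right left_minus
      right_minus zero_power2 power_zero_numeral diff_0 minus_zero diff_zero) Groebner_Basis.algebra

text \<open>Here q measures the deviation from the expected value \<open>c ^ 3\<close>; the lowest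
  term is \<open>18 q T^6\<close>.\<close>

lemma assoc_lead_cube_coeffs_defect:
  fixes c q T :: "'a::idom"
  shows "assoc_lead ((cube_coeffs c)(9 := c ^ 3 + q)) (- T) T T - assoc_lead ((cube_coeffs c)(9 := c ^ 3
      + q)) T T (- T) =
    poly [:0, 0, 0, 0, 0, 0, 18 * q, 0, - 108 * c * q, 0, 270 * c ^ 2 * q, 0, - 360 * c ^ 3 * q - 360 * q ^ 2, 0,
        1080 * c * q ^ 2 + 270 * c ^ 4 * q, 0, - 1080 * c ^ 2 * q ^ 2 - 108 * c ^ 5 * q, 0, 360 * c ^ 3 * q ^ 2
        + 18 * c ^ 6 * q + 342 * q ^ 3:] T"
  by (simp only: assoc_lead_def cubic_resultant_def Let_def zcoeff_defs cube_coeffs_simps fun_upd_apply poly_pCons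
      poly_0 num.distinct num.inject numeral_eq_iff one_eq_numeral_iff zero_neq_numeral numeral_eq_one_iff if_True
      if_False simp_thms mult_zero_left mult_zero_right add_0_left add_0_right left_minus right_minus zero_power2
      power_zero_numeral diff_0 minus_zero diff_zero) Groebner_Basis.algebra

text \<open>
  The curve \<open>a\<^sup>3 = x (1 - c x\<^sup>2)\<close> behind the first family is the Fermat symmetric_cubic: with \<open>k\<^sup>2 = - 3 c\<close>,
  \<open>m\<^sub>i = k x\<^sub>i - 1\<close> and \<open>n\<^sub>i = k x\<^sub>i + 1\<close>, the polynomial becomes
  \<open>((m\<^sub>1 m\<^sub>2 m\<^sub>3 + n\<^sub>1 n\<^sub>2 n\<^sub>3)\<^sup>3 - \<Prod>i. (m\<^sub>i\<^sup>3 + n\<^sub>i\<^sup>3)) / (8 k\<^sup>3)\<close>, for which the symmetry of the resultant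
  has few terms.
\<close>

definition fermat_res :: "'a::comm_ring_1 \<Rightarrow> 'a \<Rightarrow> 'a \<Rightarrow> 'a \<Rightarrow> 'a \<Rightarrow> 'a \<Rightarrow> 'a \<Rightarrow> 'a \<Rightarrow> 'a" where
  "fermat_res x x' y y' z z' t t' =
    (let p = x * y; r = x' * y'; A = (x ^ 3 + x' ^ 3) * (y ^ 3 + y' ^ 3);
         q = z * t; s = z' * t'; B = (z ^ 3 + z' ^ 3) * (t ^ 3 + t' ^ 3)
     in cubic_resultant (r ^ 3 - A) (3 * p * r ^ 2) (3 * p ^ 2 * r) (p ^ 3 - A)
             (q ^ 3 - B) (3 * q ^ 2 * s) (3 * q * s ^ 2) (s ^ 3 - B))"

text \<open>With m = k w - 1 and n = k w + 1, the two cubics are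
  \<open>(p m + r n)^3 - A (m^3 + n^3)\<close> and \<open>(q n + s m)^3 - B (m^3 + n^3)\<close>,
  regarded as polynomials in m / n. The roles of m and n are exchanged in the second because w is
  negated there.\<close>

lemma fermat_res_swap:
  fixes t' :: "'a::idom"
  shows "fermat_res x x' y y' z z' t t' = fermat_res z z' y y' x x' t t'"
  unfolding fermat_res_def cubic_resultant_def Let_def by Groebner_Basis.algebra

text \<open>These are the coefficients in w of \<open>8 k^3 R(x,y,w)\<close>, in the shape that
  \<open>cubic_resultant_mobius\<close> expects.\<close>

lemma elliptic_coeffs_mobius:
  fixes k x y :: "'a::idom"
  defines "p \<equiv> (k * x - 1) * (k * y - 1)" and "r \<equiv> (k * x + 1) * (k * y + 1)"
    and "A \<equiv> ((k * x - 1) ^ 3 + (k * x + 1) ^ 3) * ((k * y - 1) ^ 3 + (k * y + 1) ^ 3)"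
  assumes c: "- 3 * c = k ^ 2"
  shows "8 * k ^ 3 * zcoeff0 x y = (r ^ 3 - A) - 3 * p * r ^ 2 + 3 * p ^ 2 * r - (p ^ 3 - A)"
    "8 * k ^ 3 * zcoeff1 (elliptic_coeffs c) x y = k * (3 * (r ^ 3 - A) - 3 * p * r ^ 2 - 3 * p ^ 2 * r
        + 3 * (p ^ 3 - A))"
    "8 * k ^ 3 * zcoeff2 (elliptic_coeffs c) x y = k ^ 2 * (3 * (r ^ 3 - A)
        + 3 * p * r ^ 2 - 3 * p ^ 2 * r - 3 * (p ^ 3 - A))"
    "8 * k ^ 3 * zcoeff3 (elliptic_coeffs c) x y = k ^ 3 * ((r ^ 3 - A) + 3 * p * r ^ 2 + 3 * p ^ 2 * r
        + (p ^ 3 - A))"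
proof -
  have k2: "k ^ 2 = - (3 * c)"
    using c by simp
  then have "(k ^ 2) ^ 2 = 9 * c ^ 2"
    by (simp add: power2_eq_square)
  then have k4: "k ^ 4 = 9 * c ^ 2"
    by (simp flip: power_mult)
  \<comment> \<open>Eliminating c in favour of k leaves polynomial identities in the unconstrained
    k, x, y.\<close>
  have f: "elliptic_coeffs c 0 = - 27" "elliptic_coeffs c 1 = 0" "elliptic_coeffs c 2 = 18 * k ^ 2"
      "elliptic_coeffs c 3 = 0"
  "elliptic_coeffs c 4 = - (6 * k ^ 2)" "elliptic_coeffs c 5 = 0" "elliptic_coeffs c 6 = 9 * k ^ 4"
      "elliptic_coeffs c 7 = - (3 * k ^ 4)"
  "elliptic_coeffs c 8 = 0" "elliptic_coeffs c 9 = 0"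
    unfolding elliptic_coeffs_simps using k2 k4 by simp_all
  show "8 * k ^ 3 * zcoeff0 x y = (r ^ 3 - A) - 3 * p * r ^ 2 + 3 * p ^ 2 * r - (p ^ 3 - A)"
    "8 * k ^ 3 * zcoeff1 (elliptic_coeffs c) x y = k * (3 * (r ^ 3 - A) - 3 * p * r ^ 2 - 3 * p ^ 2 * r
        + 3 * (p ^ 3 - A))"
    "8 * k ^ 3 * zcoeff2 (elliptic_coeffs c) x y = k ^ 2 * (3 * (r ^ 3 - A)
        + 3 * p * r ^ 2 - 3 * p ^ 2 * r - 3 * (p ^ 3 - A))"
    "8 * k ^ 3 * zcoeff3 (elliptic_coeffs c) x y = k ^ 3 * ((r ^ 3 - A) + 3 * p * r ^ 2 + 3 * p ^ 2 * r
        + (p ^ 3 - A))"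
    unfolding p_def r_def A_def zcoeff_defs f by Groebner_Basis.algebra+
qed

lemma assoc_resultant_elliptic_coeffs_eq_fermat:
  fixes k x y z t :: "'a::idom"
  assumes "- 3 * c = k ^ 2"
  shows "(8 * k ^ 3) ^ 6 * assoc_resultant (elliptic_coeffs c) x y z t = - ((2 * k) ^ 9 *
    fermat_res (k * x - 1) (k * x + 1) (k * y - 1) (k * y + 1) (k * z - 1) (k * z + 1) (k * t - 1) (k * t + 1))"
proof -
  define d where "d = 8 * k ^ 3"
  define p r A where "p = (k * x - 1) * (k * y - 1)" and "r = (k * x + 1) * (k * y + 1)"
    and "A = ((k * x - 1) ^ 3 + (k * x + 1) ^ 3) * ((k * y - 1) ^ 3 + (k * y + 1) ^ 3)"
  define q s B where "q = (k * z - 1) * (k * t - 1)" and "s = (k * z + 1) * (k * t + 1)"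
    and "B = ((k * z - 1) ^ 3 + (k * z + 1) ^ 3) * ((k * t - 1) ^ 3 + (k * t + 1) ^ 3)"
  note xy = elliptic_coeffs_mobius[OF assms, of x y, folded d_def p_def r_def A_def]
  note zt = elliptic_coeffs_mobius[OF assms, of z t, folded d_def q_def s_def B_def]
  define a0 a1 a2 a3 where "a0 = r ^ 3 - A" and "a1 = 3 * p * r ^ 2" and "a2 = 3 * p ^ 2 * r" and "a3 = p ^ 3 - A"
  define b0 b1 b2 b3 where "b0 = q ^ 3 - B" and "b1 = 3 * q ^ 2 * s" and "b2 = 3 * q * s ^ 2" and "b3 = s ^ 3 - B"
  have a: "d * zcoeff0 x y = a0 - a1 + a2 - a3"
      "d * zcoeff1 (elliptic_coeffs c) x y = k * (3 * a0 - a1 - a2 + 3 * a3)"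
    "d * zcoeff2 (elliptic_coeffs c) x y = k ^ 2 * (3 * a0 + a1 - a2 - 3 * a3)"
        "d * zcoeff3 (elliptic_coeffs c) x y = k ^ 3 * (a0 + a1 + a2 + a3)"
    unfolding xy a0_def a1_def a2_def a3_def by (rule refl)+
  \<comment> \<open>Negating w sends m to -n and n to -m, and the cubic forms are odd; hence the
    second cubic is scaled by -d instead of d.\<close>
  have "(- d) * zcoeff0 z t = - (d * zcoeff0 z t)"
      "(- d) * - zcoeff1 (elliptic_coeffs c) z t = d * zcoeff1 (elliptic_coeffs c) z t"
    "(- d) * zcoeff2 (elliptic_coeffs c) z t = - (d * zcoeff2 (elliptic_coeffs c) z t)"
        "(- d) * - zcoeff3 (elliptic_coeffs c) z t = d * zcoeff3 (elliptic_coeffs c) z t"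
    by simp_all
  then have b: "(- d) * zcoeff0 z t = b0 - b1 + b2 - b3"
      "(- d) * - zcoeff1 (elliptic_coeffs c) z t = k * (3 * b0 - b1 - b2 + 3 * b3)"
    "(- d) * zcoeff2 (elliptic_coeffs c) z t = k ^ 2 * (3 * b0 + b1 - b2 - 3 * b3)"
        "(- d) * - zcoeff3 (elliptic_coeffs c) z t = k ^ 3 * (b0 + b1 + b2 + b3)"
    unfolding zt b0_def b1_def b2_def b3_def by (simp_all add: algebra_simps)
  have "d ^ 3 * (- d) ^ 3 * assoc_resultant (elliptic_coeffs c) x y z t =
      (2 * k) ^ 9 * cubic_resultant a0 a1 a2 a3 b0 b1 b2 b3"
    unfolding assoc_resultant_def cubic_resultant_scale [symmetric] a b by (rule cubic_resultant_mobius)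
  also have "d ^ 3 * (- d) ^ 3 = - (d ^ 6)"
    by (simp flip: power_add)
  finally have "d ^ 6 * assoc_resultant (elliptic_coeffs c) x y z t =
      - ((2 * k) ^ 9 * cubic_resultant a0 a1 a2 a3 b0 b1 b2 b3)"
    by (simp only: mult_minus_left minus_equation_iff[of "d ^ 6 * assoc_resultant (elliptic_coeffs c) x y z t"])
  then show ?thesis
    unfolding fermat_res_def Let_def a0_def a1_def a2_def a3_def b0_def b1_def b2_def b3_def
      p_def r_def A_def q_def s_def B_def d_def .
qed

text \<open>For c = 0 the change of variable degenerates, as k would be 0; the polynomial is then
  short enough for a direct check.\<close>

lemma assoc_resultant_elliptic_coeffs_0:
  fixes x y z t :: "'a::idom"
  shows "assoc_resultant (elliptic_coeffs 0) x y z t = assoc_resultant (elliptic_coeffs 0) z y x t"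
proof -
  have c: "zcoeff1 (elliptic_coeffs 0) x y = 3 * (x + y) ^ 2 - 27 * x * y"
      "zcoeff2 (elliptic_coeffs 0) x y = 3 * (x + y)" "zcoeff3 (elliptic_coeffs 0) x y = 1" for x y :: 'a
    by (simp_all add: zcoeff_defs elliptic_coeffs_simps flip: One_nat_def)
  show ?thesis
    unfolding assoc_resultant_def c zcoeff0_def cubic_resultant_def Let_def by Groebner_Basis.algebra
qed

lemma assoc_resultant_elliptic_coeffs:
  fixes x y z t :: "'a::alg_closed_field"
  assumes "(2 :: 'a) \<noteq> 0" "(3 :: 'a) \<noteq> 0"
  shows "assoc_resultant (elliptic_coeffs c) x y z t = assoc_resultant (elliptic_coeffs c) z y x t"
proof (cases "c = 0")
  case True
  then show ?thesis
    by (simp add: assoc_resultant_elliptic_coeffs_0)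
next
  case False
  \<comment> \<open>A square root of -3 c is needed for the Fermat form. As c and 3 are nonzero, so
    is k, and the factor \<open>(8 * k ^ 3) ^ 6\<close> can be cancelled.\<close>
  obtain k where "poly [:3 * c, 0, 1:] k = 0"
    using alg_closed_imp_poly_has_root[of "[:3 * c, 0, 1:]"] by auto
  then have k: "- 3 * c = k ^ 2"
    by (simp add: power2_eq_square add_eq_0_iff)
  have "(8 * k ^ 3) ^ 6 * assoc_resultant (elliptic_coeffs c) x y z t =
      (8 * k ^ 3) ^ 6 * assoc_resultant (elliptic_coeffs c) z y x t"
    by (simp only: assoc_resultant_elliptic_coeffs_eq_fermat[OF k] fermat_res_swap[of "k * x - 1"])
  moreover have "(8 * k ^ 3) ^ 6 \<noteq> 0"
  proof -
    have "k \<noteq> 0"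
      using k False assms(2) by auto
    moreover have "(8 :: 'a) = 2 ^ 3"
      by simp
    ultimately show ?thesis
      using assms(1) by (metis mult_eq_0_iff power_not_zero)
  qed
  ultimately show ?thesis
    by (metis mult_left_cancel)
qed

lemma assoc_resultant_cube_coeffs:
  fixes x y z t :: "'a::idom"
  shows "assoc_resultant (cube_coeffs c) x y z t = assoc_resultant (cube_coeffs c) z y x t"
proof -
  \<comment> \<open>Here \<open>R(x,y,w)\<close> is the cube of
    \<open>(x + y) + (1 + c x y) w\<close>, so the resultant is a ninth power. Its base, once
    expanded, is symmetric in all four arguments.\<close>
  have "assoc_resultant (cube_coeffs c) x y z t = ((1 + c * (x * y)) * (z + t) + (x + y) * (1
      + c * (z * t))) ^ 9" for x y z t
  proof -
    have c: "zcoeff1 (cube_coeffs c) x y = 3 * (x + y) ^ 2 * (1 + c * (x * y))"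
      "zcoeff2 (cube_coeffs c) x y = 3 * (x + y) * (1 + c * (x * y)) ^ 2"
          "zcoeff3 (cube_coeffs c) x y = (1 + c * (x * y)) ^ 3" for x y
      by (simp_all add: zcoeff_defs cube_coeffs_simps algebra_simps power2_eq_square power3_eq_cube flip:
          One_nat_def)
    have cube: "(- u) ^ 3 = - (u ^ 3)" for u :: 'a
      by simp
    have "assoc_resultant (cube_coeffs c) x y z t =
        cubic_resultant ((x + y) ^ 3) (3 * (x + y) ^ 2 * (1 + c * (x * y)))
        (3 * (x + y) * (1 + c * (x * y)) ^ 2) ((1 + c * (x * y)) ^ 3)
        ((z + t) ^ 3) (3 * (z + t) ^ 2 * - (1 + c * (z * t)))
        (3 * (z + t) * (- (1 + c * (z * t))) ^ 2) ((- (1 + c * (z * t))) ^ 3)"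
      unfolding assoc_resultant_def c zcoeff0_def by (simp only: mult_minus_right power2_minus cube)
    also have "\<dots> = ((1 + c * (x * y)) * (z + t) - (x + y) * - (1 + c * (z * t))) ^ 9"
      by (rule cubic_resultant_cubes)
    finally show ?thesis
      by (simp only: mult_minus_right diff_minus_eq_add)
  qed
  then show ?thesis
    by (simp add: algebra_simps)
qed

lemma assoc_lead_commute: "assoc_lead k y x z = assoc_lead k x y z"
  by (simp only: assoc_lead_def zcoeff_commute)

lemma assoc_resultant_commute: "assoc_resultant k y x z t = assoc_resultant k x y z t"
  by (simp only: assoc_resultant_def zcoeff_commute)

section \<open>Passing between generic and numerical arguments\<close>

lemma assoc_lead_origin: "zcoeff3 k 0 0 = 1" "assoc_lead k 0 0 0 = 1" "symmetric_cubic k x 0 0 = x ^ 3"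
  by (simp_all add: assoc_lead_def cubic_resultant_def zcoeff_defs symmetric_cubic_def)

text \<open>The generic field contains the complex numbers and is therefore infinite.\<close>

lemma generic_poly_eqI:
  fixes p q :: "generic poly"
  assumes "\<And>t. poly p t = poly q t"
  shows "p = q"
proof (rule ccontr)
  assume "p \<noteq> q"
  then have "finite {t. poly (p - q) t = 0}"
    by (intro poly_roots_finite) simp
  with assms have "finite (UNIV :: generic set)"
    by simp
  moreover have "inj (\<lambda>c. gen (const3 c))"
    by (auto simp: inj_def const3_def)
  ultimately have "finite (UNIV :: complex set)"
    by (metis finite_imageD finite_subset subset_UNIV)
  then show False
    by (simp add: infinite_UNIV_char_0)
qed

context
  fixes k :: "nat \<Rightarrow> complex" and k' :: "nat \<Rightarrow> generic" and x y z :: generic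
  defines "k' \<equiv> \<lambda>i. gen (const3 (k i))"
    and "x \<equiv> gen varx" and "y \<equiv> gen vary" and "z \<equiv> gen varz"
begin

text \<open>One nonzero specialization suffices for a generic element to be nonzero; below, the
  point is the origin or (1,0,0).\<close>

lemma generic_value_nonzero:
  assumes "eval3 id R a b c \<noteq> 0"
  shows "gen R \<noteq> 0"
proof
  assume "gen R = 0"
  then have "R = 0"
    using gen_eq_iff[of R 0] by simp
  with assms show False by simp
qed

lemma generic_zcoeff3_nonzero: "zcoeff3 k' (- x) (- y) \<noteq> 0" "zcoeff3 k' (- y) (- z) \<noteq> 0"
  using generic_value_nonzero[of "zcoeff3 (\<lambda>i. const3 (k i)) (- varx) (- vary)" 0 0 0]
    generic_value_nonzero[of "zcoeff3 (\<lambda>i. const3 (k i)) (- vary) (- varz)" 0 0 0]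
  by (simp_all add: gen.morphism_zcoeff k'_def x_def y_def z_def ring_morphism.morphism_zcoeff[OF
      ring_morphism_eval3[OF ring_morphism_id]] assoc_lead_origin)

lemma generic_assoc_lead_nonzero: "assoc_lead k' (- x) (- y) (- z) \<noteq> 0" "assoc_lead k' (- y) (- z) (- x) \<noteq> 0"
  using generic_value_nonzero[of "assoc_lead (\<lambda>i. const3 (k i)) (- varx) (- vary) (- varz)" 0 0 0]
    generic_value_nonzero[of "assoc_lead (\<lambda>i. const3 (k i)) (- vary) (- varz) (- varx)" 0 0 0]
  by (simp_all add: gen.morphism_assoc_lead k'_def x_def y_def z_def ring_morphism.morphism_assoc_lead[OF
      ring_morphism_eval3[OF ring_morphism_id]] assoc_lead_origin)

lemma generic_cubic_nonzero: "symmetric_cubic k' (- x) (- y) (- z) \<noteq> 0"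
  using generic_value_nonzero[of "symmetric_cubic (\<lambda>i. const3 (k i)) (- varx) (- vary) (- varz)" 1 0 0]
  by (simp add: gen.morphism_symmetric_cubic k'_def x_def y_def z_def ring_morphism.morphism_symmetric_cubic[OF
      ring_morphism_eval3[OF ring_morphism_id]] assoc_lead_origin)

lemma iterated_generic:
  "poly (iterated (symmetric_cubic_poly k) x y z) t * assoc_lead k' (- x) (- y) (- z) =
      assoc_resultant k' (- x) (- y) (- z) t"
  "poly (iterated (symmetric_cubic_poly k) y z x) t * assoc_lead k' (- y) (- z) (- x) =
      assoc_resultant k' (- y) (- z) (- x) t"
  using iterated_symmetric_cubic_poly[of k x y z t] iterated_symmetric_cubic_poly[of k y z x t]
      generic_zcoeff3_nonzero generic_assoc_lead_nonzero
  by (simp_all add: k'_def)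

text \<open>Both iterated polynomials are monic, so equality of their multiples by
  \<open>assoc_lead\<close> forces these factors, and then the polynomials themselves, to
  agree.\<close>

lemma generically_associative_symmetric_cubic_poly_I:
  assumes assoc_resultant: "\<And>t. assoc_resultant k' (- x) (- y) (- z) t = assoc_resultant k' (- y) (- z) (- x) t"
  shows "generically_associative (symmetric_cubic_poly k)"
proof -
  let ?l = "assoc_lead k' (- x) (- y) (- z)" and ?l' = "assoc_lead k' (- y) (- z) (- x)"
  have eq: "Polynomial.smult ?l (iterated (symmetric_cubic_poly k) x y z) =
      Polynomial.smult ?l' (iterated (symmetric_cubic_poly k) y z x)"
    by (rule generic_poly_eqI) (simp add: iterated_generic assoc_resultant mult.commute[of "assoc_lead _ _ _ _"])
  then have "?l = ?l'"
    using iterated_monic by (metis lead_coeff_smult mult_1_right)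
  then have "iterated (symmetric_cubic_poly k) x y z = iterated (symmetric_cubic_poly k) y z x"
    using eq generic_assoc_lead_nonzero(2) by (metis smult_cancel)
  then show ?thesis
    by (simp add: generically_associative_symmetric_cubic_poly_iff_iterated x_def y_def z_def)
qed

text \<open>At t = 0 both resultants equal the cube of the same nonzero value of R. This identifies
  the two leading coefficients, after which the equation for general t follows.\<close>

lemma generically_associative_symmetric_cubic_poly_D:
  assumes "generically_associative (symmetric_cubic_poly k)"
  shows "assoc_lead k' (- x) (- y) (- z) = assoc_lead k' (- y) (- z) (- x)"
    and "assoc_resultant k' (- x) (- y) (- z) t = assoc_resultant k' (- y) (- z) (- x) t"
proof -
  have it: "iterated (symmetric_cubic_poly k) x y z = iterated (symmetric_cubic_poly k) y z x"
    using assms by (simp add: generically_associative_symmetric_cubic_poly_iff_iterated x_def y_def z_def)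
  have "symmetric_cubic k' (- y) (- z) (- x) = symmetric_cubic k' (- x) (- y) (- z)"
    by (metis symmetric_cubic_swap symmetric_cubic_swap')
  then have "poly (iterated (symmetric_cubic_poly k) x y z) 0 * assoc_lead k' (- x) (- y) (- z) =
      poly (iterated (symmetric_cubic_poly k) x y z) 0 * assoc_lead k' (- y) (- z) (- x)"
    and "poly (iterated (symmetric_cubic_poly k) x y z) 0 \<noteq> 0"
    using iterated_generic[of 0] generic_cubic_nonzero by (auto simp: assoc_resultant_0 it)
  then show L: "assoc_lead k' (- x) (- y) (- z) = assoc_lead k' (- y) (- z) (- x)"
    by simp
  show "assoc_resultant k' (- x) (- y) (- z) t = assoc_resultant k' (- y) (- z) (- x) t"
    using iterated_generic[of t] by (simp add: it L)
qed

end

text \<open>The embedding \<open>gen\<close> is injective, so for each numerical t the generic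
  equation is one between polynomials in x, y, z, which can be evaluated anywhere.\<close>

lemma associative_imp_resultant_symmetric:
  assumes "generically_associative (symmetric_cubic_poly k)"
  shows "assoc_resultant k x y z t = assoc_resultant k z y x t" "assoc_lead k x y z = assoc_lead k z y x"
proof -
  interpret ev: ring_morphism "\<lambda>P. eval3 id P (- x) (- y) (- z)"
    by (rule ring_morphism_eval3) simp
  have "gen (assoc_resultant (\<lambda>i. const3 (k i)) (- varx) (- vary) (- varz) (const3 t)) =
        gen (assoc_resultant (\<lambda>i. const3 (k i)) (- vary) (- varz) (- varx) (const3 t))"
    using generically_associative_symmetric_cubic_poly_D(2)[OF assms,
        of "gen (const3 t)"] by (simp add: gen.morphism_assoc_resultant)
  then have "eval3 id (assoc_resultant (\<lambda>i. const3 (k i)) (- varx) (- vary) (- varz) (const3 t)) (- x) (- y) (- z) =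
     eval3 id (assoc_resultant (\<lambda>i. const3 (k i)) (- vary) (- varz) (- varx) (const3 t)) (- x) (- y) (- z)"
    by (simp only: gen_eq_iff)
  then show "assoc_resultant k x y z t = assoc_resultant k z y x t"
    by (simp add: ev.morphism_assoc_resultant assoc_resultant_commute[of k y z])
  have "gen (assoc_lead (\<lambda>i. const3 (k i)) (- varx) (- vary) (- varz)) =
        gen (assoc_lead (\<lambda>i. const3 (k i)) (- vary) (- varz) (- varx))"
    using generically_associative_symmetric_cubic_poly_D(1)[OF assms] by (simp add: gen.morphism_assoc_lead)
  then have "eval3 id (assoc_lead (\<lambda>i. const3 (k i)) (- varx) (- vary) (- varz)) (- x) (- y) (- z) =
     eval3 id (assoc_lead (\<lambda>i. const3 (k i)) (- vary) (- varz) (- varx)) (- x) (- y) (- z)"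
    by (simp only: gen_eq_iff)
  then show "assoc_lead k x y z = assoc_lead k z y x"
    by (simp add: ev.morphism_assoc_lead assoc_lead_commute[of k y z])
qed

context ring_morphism
begin

text \<open>Stated for \<open>assoc_resultant\<close>, which reads only the indices 0 to 9: beyond
  them the list entries are unspecified and \<open>h\<close> need not carry them over.\<close>

lemma morphism_elliptic_coeffs: "assoc_resultant (\<lambda>i. h (elliptic_coeffs c i)) =
    assoc_resultant (elliptic_coeffs (h c))"
  by (simp add: fun_eq_iff assoc_resultant_def zcoeff_defs elliptic_coeffs_simps flip: One_nat_def)

lemma morphism_cube_coeffs: "assoc_resultant (\<lambda>i. h (cube_coeffs c i)) = assoc_resultant (cube_coeffs (h c))"
  by (simp add: fun_eq_iff assoc_resultant_def zcoeff_defs cube_coeffs_simps flip: One_nat_def)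

end

lemma generically_associative_elliptic_coeffs: "generically_associative (symmetric_cubic_poly (elliptic_coeffs c))"
proof (rule generically_associative_symmetric_cubic_poly_I)
  have "(2 :: generic) \<noteq> 0" "(3 :: generic) \<noteq> 0"
    using generic_value_nonzero[of 2 0 0 0] generic_value_nonzero[of 3 0 0 0] by simp_all
  note assoc_resultant_elliptic_coeffs[OF this]
  then show "assoc_resultant (\<lambda>i. gen (const3 (elliptic_coeffs c i))) (- gen varx) (- gen vary) (- gen varz) t =
      assoc_resultant (\<lambda>i. gen (const3 (elliptic_coeffs c i))) (- gen vary) (- gen varz) (- gen varx) t" for t
    unfolding ring_morphism.morphism_elliptic_coeffs[OF ring_morphism_gen_const3] using assoc_resultant_commute by
        metis
qed

lemma generically_associative_cube_coeffs: "generically_associative (symmetric_cubic_poly (cube_coeffs c))"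
proof (rule generically_associative_symmetric_cubic_poly_I)
  show "assoc_resultant (\<lambda>i. gen (const3 (cube_coeffs c i))) (- gen varx) (- gen vary) (- gen varz) t =
      assoc_resultant (\<lambda>i. gen (const3 (cube_coeffs c i))) (- gen vary) (- gen varz) (- gen varx) t" for t
    unfolding ring_morphism.morphism_cube_coeffs[OF ring_morphism_gen_const3] using assoc_resultant_cube_coeffs
        assoc_resultant_commute by metis
qed

section \<open>Symmetric polynomials of degree at most three in each variable\<close>

text \<open>Writing out all 64 coefficients makes evaluation and comparison of coefficients a matter
  of simplification.\<close>

definition box_poly :: "(nat \<Rightarrow> nat \<Rightarrow> nat \<Rightarrow> complex) \<Rightarrow> poly3" where
  "box_poly r = (let row = \<lambda>j l. [:r 0 j l, r 1 j l, r 2 j l, r 3 j l:];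
                 page = \<lambda>l. [:row 0 l, row 1 l, row 2 l, row 3 l:]
             in [:page 0, page 1, page 2, page 3:])"

lemma coeff_4: "Polynomial.coeff [:a, b, c, d:] n = (if n = 0 then a else if n = 1 then b else if n =
    2 then c else if n = 3 then d else 0)"
  by (simp add: coeff_pCons numeral_2_eq_2 numeral_3_eq_3 split: nat.splits)

lemma coeff3_box_poly: "coeff3 (box_poly r) i j l = (if i \<le> 3 \<and> j \<le> 3 \<and> l \<le> 3 then r i j l else 0)"
proof -
  have le3: "n \<le> 3 \<longleftrightarrow> n = 0 \<or> n = 1 \<or> n = 2 \<or> n = (3::nat)" for n
    by auto
  show ?thesis
    by (auto simp: coeff3_def box_poly_def Let_def coeff_4 le3)
qed

lemma poly3_eqI_coeff: "(\<And>i j l. coeff3 P i j l = coeff3 Q i j l) \<Longrightarrow> P = Q"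
  by (simp add: coeff3_def poly_eq_iff)

lemma box_poly_coeff3:
  assumes "\<And>i j l. coeff3 P i j l \<noteq> 0 \<Longrightarrow> i \<le> 3 \<and> j \<le> 3 \<and> l \<le> 3"
  shows "P = box_poly (coeff3 P)"
  using assms by (intro poly3_eqI_coeff) (auto simp: coeff3_box_poly)

lemma box_poly_eq_iff: "box_poly r = box_poly s \<longleftrightarrow> (\<forall>i\<le>3. \<forall>j\<le>3. \<forall>l\<le>3. r i j l = s i j l)"
  by (metis coeff3_box_poly poly3_eqI_coeff)

lemma eval3_box_poly:
  "eval3 id (box_poly r) x y z =
    (\<Sum>l\<in>{0,1,2,3}. \<Sum>j\<in>{0,1,2,3}. \<Sum>i\<in>{0,1,2,3}. r i j l * x ^ i * y ^ j * z ^ l)"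
  by (simp add: box_poly_def Let_def eval3_def zpoly_def eval2_def map_poly_pCons algebra_simps power2_eq_square
      power3_eq_cube)

text \<open>The expanded form of \<open>symmetric_cubic\<close>. The table is nested like
  \<open>poly3\<close>: outermost the power of z, then of y, then of x.\<close>

definition symmetric_cubic_coeff :: "(nat \<Rightarrow> complex) \<Rightarrow> nat \<Rightarrow> nat \<Rightarrow> nat \<Rightarrow> complex" where
  "symmetric_cubic_coeff k i j l =
    [[[0, 0, 0, 1],
      [0, 0, 3, 0],
      [0, 3, 0, 0],
      [1, 0, 0, 0]],
     [[0, 0, 3, 0],
      [0, 6 + k 0, k 1, k 4],
      [3, k 1, k 2 + 2 * k 4, k 5],
      [0, k 4, k 5, k 7]],
     [[0, 3, 0, 0],
      [3, k 1, k 2 + 2 * k 4, k 5],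
      [0, k 2 + 2 * k 4, k 3 + 3 * k 5, k 6 + 2 * k 7],
      [0, k 5, k 6 + 2 * k 7, k 8]],
     [[1, 0, 0, 0],
      [0, k 4, k 5, k 7],
      [0, k 5, k 6 + 2 * k 7, k 8],
      [0, k 7, k 8, k 9]]] ! l ! j ! i"

lemma eval3_symmetric_cubic_coeff: "eval3 id (box_poly (symmetric_cubic_coeff k)) x y z = symmetric_cubic k x y z"
  unfolding eval3_box_poly symmetric_cubic_coeff_def by (simp add: symmetric_cubic_def zcoeff_defs algebra_simps
      power2_eq_square power3_eq_cube)

lemma symmetric_cubic_poly_box_poly: "symmetric_cubic_poly k =
    box_poly (\<lambda>i j l. (- 1) ^ (i + j) * symmetric_cubic_coeff k i j l)"
proof (rule poly3_eqI)
  fix a b c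
  have "eval3 id (box_poly (\<lambda>i j l. (- 1) ^ (i + j) * symmetric_cubic_coeff k i j l)) a b c =
      eval3 id (box_poly (symmetric_cubic_coeff k)) (- a) (- b) c"
    by (simp add: eval3_box_poly)
  then show "eval3 id (symmetric_cubic_poly k) a b c =
      eval3 id (box_poly (\<lambda>i j l. (- 1) ^ (i + j) * symmetric_cubic_coeff k i j l)) a b c"
    by (simp add: eval3_symmetric_cubic_coeff eval3_symmetric_cubic_poly)
qed

text \<open>The two adjacent transpositions generate all permutations, so they suffice to transfer
  symmetry from values to coefficients.\<close>

lemma box_poly_swap:
  assumes "\<And>a b c. eval3 id (box_poly r) a b c = eval3 id (box_poly r) b a c"
    and "\<And>a b c. eval3 id (box_poly r) a b c = eval3 id (box_poly r) a c b"
    and "i \<le> 3" "j \<le> 3" "l \<le> 3"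
  shows "r i j l = r j i l" "r i j l = r i l j"
proof -
  have "box_poly r = box_poly (\<lambda>i j l. r j i l)"
  proof (rule poly3_eqI)
    fix a b c
    have "eval3 id (box_poly r) b a c = eval3 id (box_poly (\<lambda>i j l. r j i l)) a b c"
      unfolding eval3_box_poly
      by (rule sum.cong[OF refl], subst sum.swap) (simp only: mult_ac)
    with assms(1) show "eval3 id (box_poly r) a b c = eval3 id (box_poly (\<lambda>i j l. r j i l)) a b c"
      by simp
  qed
  then show "r i j l = r j i l"
    using assms(3-) by (simp add: box_poly_eq_iff)
  have "box_poly r = box_poly (\<lambda>i j l. r i l j)"
  proof (rule poly3_eqI)
    fix a b c
    have "eval3 id (box_poly r) a c b = eval3 id (box_poly (\<lambda>i j l. r i l j)) a b c"
      unfolding eval3_box_poly by (subst sum.swap) (simp only: mult_ac)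
    with assms(2) show "eval3 id (box_poly r) a b c = eval3 id (box_poly (\<lambda>i j l. r i l j)) a b c"
      by simp
  qed
  then show "r i j l = r i l j"
    using assms(3-) by (simp add: box_poly_eq_iff)
qed

lemma eval2_morphism:
  assumes "ring_morphism h" "ring_morphism g"
  shows "g (eval2 h F x y) = eval2 (\<lambda>c. g (h c)) F (g x) (g y)"
proof -
  interpret h: ring_morphism h by fact
  interpret g: ring_morphism g by fact
  show ?thesis
    by (simp add: eval2_def g.poly_map_poly_comp)
qed

lemma cubic_values_eqD:
  fixes a0 :: complex
  assumes "\<And>z. a0 + a1 * z + a2 * z ^ 2 + a3 * z ^ 3 = b0 + b1 * z + b2 * z ^ 2 + b3 * z ^ 3"
  shows "a0 = b0" "a1 = b1" "a2 = b2" "a3 = b3"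
proof -
  have "[:a0, a1, a2, a3:] = [:b0, b1, b2, b3:]"
    by (rule poly_ext) (use assms in \<open>simp add: algebra_simps power2_eq_square power3_eq_cube\<close>)
  then show "a0 = b0" "a1 = b1" "a2 = b2" "a3 = b3"
    by simp_all
qed

lemma box_poly_neutral:
  assumes "\<And>y z. eval3 id (box_poly p) 0 y z = (p 0 0 3 + p 0 1 3 * y + p 0 2 3 * y ^ 2
      + p 0 3 3 * y ^ 3) * (z - y) ^ 3"
  shows "p 0 0 0 = 0" "p 0 1 0 = 0" "p 0 2 0 = 0" "p 0 3 0 = - p 0 0 3"
    "p 0 0 1 = 0" "p 0 1 1 = 0" "p 0 2 1 = 3 * p 0 0 3" "p 0 3 1 = 0"
    "p 0 0 2 = 0" "p 0 1 2 = - (3 * p 0 0 3)" "p 0 2 2 = 0" "p 0 3 2 = 0"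
    "p 0 1 3 = 0" "p 0 2 3 = 0" "p 0 3 3 = 0"
proof -
  define G where "G y = p 0 0 3 + p 0 1 3 * y + p 0 2 3 * y ^ 2 + p 0 3 3 * y ^ 3" for y
  define A where "A l y = p 0 0 l + p 0 1 l * y + p 0 2 l * y ^ 2 + p 0 3 l * y ^ 3" for l y
  have "A 0 y + A 1 y * z + A 2 y * z ^ 2 + A 3 y * z ^ 3 =
      - (y ^ 3 * G y) + 3 * y ^ 2 * G y * z + - (3 * y * G y) * z ^ 2 + G y * z ^ 3" for y z
    using assms[of y z] by (simp add: eval3_box_poly A_def G_def algebra_simps power2_eq_square power3_eq_cube)
  note A = cubic_values_eqD[OF this]
  \<comment> \<open>The constant term in z is -y^3 times the leading coefficient G. As it has degree
    at most three in y, G must be constant.\<close>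
  have "[:p 0 0 0, p 0 1 0, p 0 2 0, p 0 3 0:] = - [:0, 0, 0, p 0 0 3, p 0 1 3, p 0 2 3, p 0 3 3:]"
    by (rule poly_ext) (use A(1) in \<open>simp add: A_def G_def algebra_simps power2_eq_square power3_eq_cube\<close>)
  then show 0: "p 0 0 0 = 0" "p 0 1 0 = 0" "p 0 2 0 = 0" "p 0 3 0 = - p 0 0 3" "p 0 1 3 = 0" "p 0 2 3 = 0"
      "p 0 3 3 = 0"
    by simp_all
  have "[:p 0 0 1, p 0 1 1, p 0 2 1, p 0 3 1:] = [:0, 0, 3 * p 0 0 3:]"
    by (rule poly_ext) (use A(2) 0 in \<open>simp add: A_def G_def algebra_simps power2_eq_square power3_eq_cube\<close>)
  then show "p 0 0 1 = 0" "p 0 1 1 = 0" "p 0 2 1 = 3 * p 0 0 3" "p 0 3 1 = 0"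
    by simp_all
  have "[:p 0 0 2, p 0 1 2, p 0 2 2, p 0 3 2:] = [:0, - (3 * p 0 0 3):]"
    by (rule poly_ext) (use A(3) 0 in \<open>simp add: A_def G_def algebra_simps power2_eq_square power3_eq_cube\<close>)
  then show "p 0 0 2 = 0" "p 0 1 2 = - (3 * p 0 0 3)" "p 0 2 2 = 0" "p 0 3 2 = 0"
    by simp_all
qed

lemma symmetric_box_poly_eq_symmetric_cubic_coeff:
  assumes "\<And>a b c. eval3 id (box_poly r) a b c = eval3 id (box_poly r) b a c"
    and "\<And>a b c. eval3 id (box_poly r) a b c = eval3 id (box_poly r) a c b"
    and "\<And>y z. eval3 id (box_poly r) 0 y z = (y + z) ^ 3"
  obtains k0 k1 k2 k3 k4 k5 k6 k7 k8 k9
    where "box_poly r = box_poly (symmetric_cubic_coeff (\<lambda>i. [k0, k1, k2, k3, k4, k5, k6, k7, k8, k9] ! i))"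
proof -
  have swap: "r i j l = r j i l" "r i j l = r i l j" if "i \<le> 3" "j \<le> 3" "l \<le> 3" for i j l
    using box_poly_swap[OF assms(1,2) that] by auto
  \<comment> \<open>The free entries are the ten with indices 1 <= i <= j <= l <= 3. The list solves
    the table \<open>symmetric_cubic_coeff\<close> for them.\<close>
  define k where "k = [r 1 1 1 - 6, r 1 1 2, r 1 2 2 - 2 * r 1 1 3, r 2 2 2 - 3 * r 1 2 3, r 1 1 3, r 1 2 3,
    r 2 2 3 - 2 * r 1 3 3, r 1 3 3, r 2 3 3, r 3 3 3]"
  \<comment> \<open>Entries with i = 0 are exactly what the restriction to x = 0 sees; blanking the
    other layers allows comparison of coefficients there.\<close>
  have "box_poly (\<lambda>i j l. if i = 0 then r 0 j l else 0) = box_poly (\<lambda>i j l. if i =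
      0 then symmetric_cubic_coeff (\<lambda>i. k ! i) 0 j l else 0)"
  proof (rule poly3_eqI)
    fix a b c
    have "eval3 id (box_poly (\<lambda>i j l. if i = 0 then r 0 j l else 0)) a b c = eval3 id (box_poly r) 0 b c"
      by (simp add: eval3_box_poly)
    also have "\<dots> = eval3 id (box_poly (symmetric_cubic_coeff (\<lambda>i. k ! i))) 0 b c"
      by (simp add: assms(3) eval3_symmetric_cubic_coeff symmetric_cubic_def zcoeff_defs algebra_simps
          power2_eq_square power3_eq_cube)
    also have "\<dots> = eval3 id (box_poly (\<lambda>i j l. if i = 0 then symmetric_cubic_coeff (\<lambda>i. k ! i) 0 j l else 0)) a b c"
      by (simp add: eval3_box_poly)
    finally show "eval3 id (box_poly (\<lambda>i j l. if i = 0 then r 0 j l else 0)) a b c =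
        eval3 id (box_poly (\<lambda>i j l. if i = 0 then symmetric_cubic_coeff (\<lambda>i. k ! i) 0 j l else 0)) a b c" .
  qed
  then have 0: "r 0 j l = symmetric_cubic_coeff (\<lambda>i. k ! i) 0 j l" if "j \<le> 3" "l \<le> 3" for j l
    using that by (auto simp: box_poly_eq_iff)
  have sorted: "r i j l = symmetric_cubic_coeff (\<lambda>i. k ! i) i j l" if "i \<le> j" "j \<le> l" "l \<le> 3" for i j l
  proof (cases "i = 0")
    case True
    with 0 that show ?thesis by simp
  next
    case False
    with that have "i = 1 \<or> i = 2 \<or> i = 3" "j = 1 \<or> j = 2 \<or> j = 3" "l = 1 \<or> l = 2 \<or> l = 3"
      by linarith+
    with that(1,2) show ?thesis
      by (elim disjE) (simp_all add: symmetric_cubic_coeff_def k_def)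
  qed
  have symmetric_cubic_coeff_swap: "symmetric_cubic_coeff (\<lambda>i. k ! i) i j l =
      symmetric_cubic_coeff (\<lambda>i. k ! i) j i l"
      "symmetric_cubic_coeff (\<lambda>i. k ! i) i j l = symmetric_cubic_coeff (\<lambda>i. k ! i) i l j"
    if "i \<le> 3" "j \<le> 3" "l \<le> 3" for i j l
  proof -
    have "eval3 id (box_poly (symmetric_cubic_coeff (\<lambda>i. k ! i))) a b c =
        eval3 id (box_poly (symmetric_cubic_coeff (\<lambda>i. k ! i))) b a c"
      and "eval3 id (box_poly (symmetric_cubic_coeff (\<lambda>i. k ! i))) a b c =
          eval3 id (box_poly (symmetric_cubic_coeff (\<lambda>i. k ! i))) a c b" for a b c
      unfolding eval3_symmetric_cubic_coeff by (metis symmetric_cubic_swap symmetric_cubic_swap')+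
    from box_poly_swap[OF this that]
    show "symmetric_cubic_coeff (\<lambda>i. k ! i) i j l = symmetric_cubic_coeff (\<lambda>i. k ! i) j i l"
        "symmetric_cubic_coeff (\<lambda>i. k ! i) i j l = symmetric_cubic_coeff (\<lambda>i. k ! i) i l j" .
  qed
  have "r i j l = symmetric_cubic_coeff (\<lambda>i. k ! i) i j l" if le: "i \<le> 3" "j \<le> 3" "l \<le> 3" for i j l
  proof -
    let ?Q = "\<lambda>i j l. r i j l = symmetric_cubic_coeff (\<lambda>i. k ! i) i j l"
    have Q: "?Q a b c \<longleftrightarrow> ?Q b a c" "?Q a b c \<longleftrightarrow> ?Q a c b" if "a \<le> 3" "b \<le> 3" "c \<le> 3" for a b c
      using swap[OF that] symmetric_cubic_coeff_swap[OF that] by simp_all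
    consider "i \<le> j" "j \<le> l" | "i \<le> l" "l \<le> j" | "j \<le> i" "i \<le> l" | "j \<le> l" "l \<le> i"
      | "l \<le> i" "i \<le> j" | "l \<le> j" "j \<le> i"
      by linarith
    then show ?thesis
    proof cases
      case 1 then show ?thesis using sorted le by blast
    next
      case 2 then show ?thesis using sorted[of i l j] Q(2)[of i j l] le by blast
    next
      case 3 then show ?thesis using sorted[of j i l] Q(1)[of i j l] le by blast
    next
      case 4 then show ?thesis using sorted[of j l i] Q(1)[of i j l] Q(2)[of j i l] le by blast
    next
      case 5 then show ?thesis using sorted[of l i j] Q(2)[of i j l] Q(1)[of i l j] le by blast
    next
      case 6 then show ?thesis using sorted[of l j i] Q(1)[of i j l] Q(2)[of j i l] Q(1)[of j l i] le by blast
    qed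
  qed
  then have "box_poly r = box_poly (symmetric_cubic_coeff (\<lambda>i. k ! i))"
    by (simp add: box_poly_eq_iff)
  then show thesis
    using that unfolding k_def by blast
qed

text \<open>The coefficients are returned as an explicit list so that they can later be compared
  with the two families as functions on all indices.\<close>

lemma symmetric_algebraic_group_imp_symmetric_cubic_poly:
  assumes "symmetric_algebraic_group 3 P"
  obtains k0 k1 k2 k3 k4 k5 k6 k7 k8 k9 where "P = symmetric_cubic_poly (\<lambda>i. [k0, k1, k2, k3, k4, k5, k6, k7, k8,
      k9] ! i)"
proof -
  define p where "p = coeff3 P"
  define r where "r i j l = (- 1) ^ (i + j) * p i j l" for i j l :: nat
  have P: "P = box_poly p"
    unfolding p_def using assms
    by (intro box_poly_coeff3) (auto simp: symmetric_algebraic_group_def algebraic_group_def)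
  have r: "eval3 id (box_poly r) a b c = eval3 id P (- a) (- b) c" for a b c
    unfolding P by (simp add: eval3_box_poly r_def)
  define R where "R = subst3 P ((- 1) ^ 3 * varx) ((- 1) ^ 3 * vary) varz"
  have R: "eval3 id R a b c = eval3 id (box_poly r) a b c" for a b c
    by (simp add: R_def r)
  have sym: "subst3 R u v w = R" if "{#u, v, w#} = {#varx, vary, varz#}" for u v w
    using assms that by (auto simp: symmetric_algebraic_group_def symmetric_poly3_def R_def)
  have sym1: "eval3 id (box_poly r) a b c = eval3 id (box_poly r) b a c" for a b c
    using arg_cong[OF sym[of vary varx varz], of "\<lambda>P. eval3 id P b a c"] by (simp add: R add_mset_commute)
  have sym2: "eval3 id (box_poly r) a b c = eval3 id (box_poly r) a c b" for a b c
    using arg_cong[OF sym[of varx varz vary], of "\<lambda>P. eval3 id P a c b"] by (simp add: R add_mset_commute)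
  have F0: "Fcoeff 3 P 0 = [:[:p 0 0 3, p 1 0 3, p 2 0 3, p 3 0 3:], [:p 0 1 3, p 1 1 3, p 2 1 3, p 3 1 3:],
      [:p 0 2 3, p 1 2 3, p 2 2 3, p 3 2 3:], [:p 0 3 3, p 1 3 3, p 2 3 3, p 3 3 3:]:]"
    unfolding Fcoeff_def by (subst P) (simp add: box_poly_def Let_def coeff_4)
  have "eval2 id (Fcoeff 3 P 0) 0 0 = 1"
    using assms by (simp add: symmetric_algebraic_group_def algebraic_group_def)
  then have p003: "p 0 0 3 = 1"
    by (simp add: F0 eval2_def map_poly_pCons)
  have neutral: "eval3 id (box_poly p) 0 y z = (p 0 0 3 + p 0 1 3 * y + p 0 2 3 * y ^ 2
      + p 0 3 3 * y ^ 3) * (z - y) ^ 3" for y z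
  proof -
    have "subst3 P 0 vary varz = eval2 const3 (Fcoeff 3 P 0) 0 vary * (varz - vary) ^ 3"
      using assms by (simp add: symmetric_algebraic_group_def algebraic_group_def)
    then have "eval3 id (subst3 P 0 vary varz) 0 y z =
        eval3 id (eval2 const3 (Fcoeff 3 P 0) 0 vary * (varz - vary) ^ 3) 0 y z"
      by (rule arg_cong)
    moreover have "(\<lambda>c. eval3 id (const3 c) 0 y z) = id"
      by (simp add: fun_eq_iff)
    then have "eval3 id (eval2 const3 F 0 vary) 0 y z = eval2 id F 0 y" for F
      using eval2_morphism[OF ring_morphism_const3 ring_morphism_eval3[OF ring_morphism_id], of F 0 vary 0 y z]
      by simp
    ultimately have "eval3 id P 0 y z = eval2 id (Fcoeff 3 P 0) 0 y * (z - y) ^ 3"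
      by simp
    then show ?thesis
      by (simp add: F0 eval2_def map_poly_pCons P [symmetric] algebra_simps power2_eq_square power3_eq_cube)
  qed
  have "eval3 id (box_poly r) 0 y z = (y + z) ^ 3" for y z
    using neutral[of "- y" z] box_poly_neutral[OF neutral] p003 by (simp add: r P [symmetric] add.commute)
  then obtain k0 k1 k2 k3 k4 k5 k6 k7 k8 k9
    where k: "box_poly r = box_poly (symmetric_cubic_coeff (\<lambda>i. [k0, k1, k2, k3, k4, k5, k6, k7, k8, k9] ! i))"
    using symmetric_box_poly_eq_symmetric_cubic_coeff[OF sym1 sym2] by metis
  have "P = symmetric_cubic_poly (\<lambda>i. [k0, k1, k2, k3, k4, k5, k6, k7, k8, k9] ! i)"
  proof (rule poly3_eqI)
    fix a b c
    show "eval3 id P a b c = eval3 id (symmetric_cubic_poly (\<lambda>i. [k0, k1, k2, k3, k4, k5, k6, k7, k8,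
        k9] ! i)) a b c"
      using r[of "- a" "- b" c] by (simp add: eval3_symmetric_cubic_poly k eval3_symmetric_cubic_coeff)
  qed
  then show thesis by (rule that)
qed

lemma symmetric_cubic_perms:
  "symmetric_cubic k x z y = symmetric_cubic k x y z" "symmetric_cubic k y x z = symmetric_cubic k x y z"
      "symmetric_cubic k y z x = symmetric_cubic k x y z"
  "symmetric_cubic k z x y = symmetric_cubic k x y z" "symmetric_cubic k z y x = symmetric_cubic k x y z"
  by (metis symmetric_cubic_swap symmetric_cubic_swap')+

lemma mset_triple_eq_cases:
  assumes "{#u, v, w#} = {#x, y, z#}"
  shows "(u, v, w) \<in> {(x, y, z), (x, z, y), (y, x, z), (y, z, x), (z, x, y), (z, y, x)}"
  using assms by (auto simp: add_eq_conv_ex)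

lemma symmetric_algebraic_group_symmetric_cubic_poly:
  assumes "generically_associative (symmetric_cubic_poly k)"
  shows "symmetric_algebraic_group 3 (symmetric_cubic_poly k)"
proof -
  have "coeff3 (symmetric_cubic_poly k) i j l \<noteq> 0 \<longrightarrow> i \<le> 3 \<and> j \<le> 3 \<and> l \<le> 3" for i j l
    by (simp add: symmetric_cubic_poly_box_poly coeff3_box_poly)
  moreover have F0: "eval2 h (Fcoeff 3 (symmetric_cubic_poly k) 0) x y = zcoeff3 (\<lambda>i. h (k i)) (- x) (- y)"
    and F3: "eval2 h (Fcoeff 3 (symmetric_cubic_poly k) 3) x y = zcoeff0 (- x) (- y)" if "ring_morphism h" for h x y
  proof -
    interpret F: ring_morphism "\<lambda>F. eval2 h F x y"
      using that by (rule ring_morphism_eval2)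
    show "eval2 h (Fcoeff 3 (symmetric_cubic_poly k) 0) x y = zcoeff3 (\<lambda>i. h (k i)) (- x) (- y)"
      "eval2 h (Fcoeff 3 (symmetric_cubic_poly k) 3) x y = zcoeff0 (- x) (- y)"
      using that by (simp_all add: Fcoeff_def symmetric_cubic_poly_def Let_def coeff_4 F.morphism_zcoeff del:
          minus_pCons)
  qed
  moreover have "eval2 id (Fcoeff 3 (symmetric_cubic_poly k) 0) 0 0 = 1"
    by (simp add: F0 zcoeff3_def)
  moreover have "subst3 (symmetric_cubic_poly k) 0 vary varz =
      eval2 const3 (Fcoeff 3 (symmetric_cubic_poly k) 0) 0 vary * (varz - vary) ^ 3"
    by (simp add: F0 eval3_symmetric_cubic_poly symmetric_cubic_sigma zcoeff3_def)
  \<comment> \<open>The inverse of x is -x, because the constant term in z is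
    \<open>(- x - y) ^ 3\<close>.\<close>
  moreover have "\<forall>x. eval2 id (Fcoeff 3 (symmetric_cubic_poly k) 3) x (poly [:0, - 1:] x) = 0 \<and>
      eval2 id (Fcoeff 3 (symmetric_cubic_poly k) 3) (poly [:0, - 1:] x) x = 0"
    by (simp add: F3 zcoeff0_def)
  ultimately have "algebraic_group 3 (symmetric_cubic_poly k)"
    using assms unfolding algebraic_group_def by blast
  moreover have "symmetric_poly3 (subst3 (symmetric_cubic_poly k) ((- 1) ^ 3 * varx) ((- 1) ^ 3 * vary) varz)"
    unfolding symmetric_poly3_def
  proof (intro allI impI poly3_eqI)
    fix u v w a b c
    assume "{#u, v, w#} = {#varx, vary, varz#}"
    then have "(u, v, w) \<in> {(varx, vary, varz), (varx, varz, vary), (vary, varx, varz), (vary, varz, varx), (varz,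
        varx, vary), (varz, vary, varx)}"
      by (rule mset_triple_eq_cases)
    then have "symmetric_cubic k (eval3 id u a b c) (eval3 id v a b c) (eval3 id w a b c) = symmetric_cubic k a b c"
      using symmetric_cubic_perms[of k a b c] by auto
    then show "eval3 id (subst3 (subst3 (symmetric_cubic_poly k) ((- 1) ^ 3 * varx)
        ((- 1) ^ 3 * vary) varz) u v w) a b c =
      eval3 id (subst3 (symmetric_cubic_poly k) ((- 1) ^ 3 * varx) ((- 1) ^ 3 * vary) varz) a b c"
      by (simp add: eval3_symmetric_cubic_poly ring_morphism.morphism_symmetric_cubic[OF ring_morphism_eval3[OF
          ring_morphism_id]])
  qed
  ultimately show ?thesis
    by (simp add: symmetric_algebraic_group_def)
qed

section \<open>Consequences of associativity\<close>

lemma ring_morphism_poly_at: "ring_morphism (\<lambda>p. poly p a)"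
  by unfold_locales simp_all

text \<open>Values off the two axes determine a polynomial. This permits cancelling the powers of x
  + t and x t in \<open>assoc_resultant_jet\<close>.\<close>

lemma bivariate_eq_0I:
  fixes L :: "complex poly poly"
  assumes "\<And>u p. u \<noteq> 0 \<Longrightarrow> p \<noteq> 0 \<Longrightarrow> poly (poly L [:u:]) p = 0"
  shows "L = 0"
proof (rule ccontr)
  assume "L \<noteq> 0"
  have "poly L [:u:] = 0" if "u \<noteq> 0" for u
  proof -
    \<comment> \<open>The extra factor p covers the excluded value p = 0.\<close>
    have "poly ([:0, 1:] * poly L [:u:]) p = 0" for p
      using assms[OF that, of p] by (cases "p = 0") simp_all
    then have "[:0, 1:] * poly L [:u:] = 0"
      by (metis poly_all_0_iff_0)
    then show ?thesis by simp
  qed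
  then have "(\<lambda>u. [:u:]) ` (- {0}) \<subseteq> {x. poly L x = 0}"
    by auto
  moreover have "infinite ((\<lambda>u. [:u:]) ` (- {0 :: complex}))"
  proof
    assume "finite ((\<lambda>u. [:u:]) ` (- {0 :: complex}))"
    then have "finite (- {0 :: complex})"
      by (rule finite_imageD) (simp add: inj_on_def)
    then show False
      by (simp add: infinite_UNIV_char_0)
  qed
  ultimately show False
    using poly_roots_finite[OF \<open>L \<noteq> 0\<close>] finite_subset by blast
qed

text \<open>Solving a quadratic equation makes x + t and x t independent parameters.\<close>

lemma sum_prod_complex:
  obtains x t :: complex where "x + t = u" "x * t = p"
proof
  let ?s = "csqrt (u ^ 2 - 4 * p)"
  show "(u + ?s) / 2 + (u - ?s) / 2 = u"
    by (simp add: field_simps)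
  have "(u + ?s) / 2 * ((u - ?s) / 2) = (u ^ 2 - ?s ^ 2) / 4"
    by (simp add: field_simps power2_eq_square)
  then show "(u + ?s) / 2 * ((u - ?s) / 2) = p"
    by simp
qed

text \<open>The relations are coefficients of \<open>jet_poly\<close>; they are the ones from which
  k0, ..., k8 are solved.\<close>

lemma associative_coefficient_relations:
  fixes k0 k1 k2 k3 k4 k5 k6 k7 k8 k9 :: complex
  assumes "generically_associative (symmetric_cubic_poly (\<lambda>i. [k0, k1, k2, k3, k4, k5, k6, k7, k8, k9] ! i))"
  shows "- (27 * k0 ^ 2 + k0 ^ 3) = 0" "- (54 * k0 * k7 + 27 * k2 ^ 2 + k0 * k2 ^ 2 + 2 * k0 ^ 2 * k7) = 0"
    "- (27 * k7 ^ 2 + k0 * k7 ^ 2) = 0" "- (18 * k0 * k1 + 2 * k0 ^ 2 * k1) = 0"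
    "- (18 * k0 * k5 + 18 * k1 * k2 + 2 * k0 * k1 * k2 + 2 * k0 ^ 2 * k5) = 0"
    "18 * k0 * k2 - 3 * k1 ^ 2 - k0 * k1 ^ 2 - 2 * k0 ^ 2 * k4 = 0"
    "48 * k0 * k7 - 6 * k1 * k5 + 6 * k2 ^ 2 - 2 * k0 * k1 * k5 - 2 * k0 * k2 * k4 = 0"
    "18 * k2 * k7 - 3 * k5 ^ 2 - 2 * k0 * k4 * k7 - k0 * k5 ^ 2 = 0"
    "- 6 * k3 + 2 * k0 * k3 + 12 * k0 * k5 + 4 * k1 * k2 + 2 * k1 * k4 - 2 * k0 * k1 * k4 = 0"
    "- 6 * k8 + 2 * k0 * k8 + 8 * k1 * k7 + 6 * k2 * k5 + 2 * k4 * k5 - 2 * k0 * k4 * k5 = 0"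
    "- 6 * k6 - 3 * k7 + 2 * k0 * k6 - 5 * k0 * k7 + 3 * k1 * k5 + k2 * k4 + 2 * k4 ^ 2 - k0 * k4 ^ 2 = 0"
proof -
  define k where "k = (\<lambda>i. [k0, k1, k2, k3, k4, k5, k6, k7, k8, k9] ! i)"
  define L where "L = jet_poly k0 k1 k2 k3 k4 k5 k6 k7 k8"
  have jet: "(x + t) ^ 3 * (x * t) ^ 2 * poly (poly L [:x + t:]) (x * t) = 0" for x t
  proof -
    have "assoc_resultant (\<lambda>i. [:k i:]) [:x:] [:0, 1:] [:0, 1:] [:t:] =
        assoc_resultant (\<lambda>i. [:k i:]) [:x:] [:t:] [:0, 1:] [:0, 1:]"
    proof (rule poly_ext)
      fix s :: complex
      interpret ring_morphism "\<lambda>p. poly p s"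
        by (rule ring_morphism_poly_at)
      \<comment> \<open>The evident symmetries within the first and within the second pair of
        arguments reduce the claim to the exchange of x and z.\<close>
      have "assoc_resultant k x s s t = assoc_resultant k s x t s"
        by (metis assoc_resultant_commute assoc_resultant_def zcoeff_commute)
      also have "\<dots> = assoc_resultant k x t s s"
        using associative_imp_resultant_symmetric(1)[OF assms, of s x t s] assoc_resultant_commute by (metis k_def)
      finally show "poly (assoc_resultant (\<lambda>i. [:k i:]) [:x:] [:0, 1:] [:0, 1:] [:t:]) s =
          poly (assoc_resultant (\<lambda>i. [:k i:]) [:x:] [:t:] [:0, 1:] [:0, 1:]) s"
        by (simp add: morphism_assoc_resultant)
    qed
    then have "0 = (x + t) ^ 3 * (x * t) ^ 2 * poly (poly L [:x + t:]) (x * t)"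
      using assoc_resultant_jet[of k0 k1 k2 k3 k4 k5 k6 k7 k8 k9 x t]
      by (simp only: k_def L_def diff_self)
    then show ?thesis by simp
  qed
  have "L = 0"
  proof (rule bivariate_eq_0I)
    fix u p :: complex
    assume "u \<noteq> 0" "p \<noteq> 0"
    moreover obtain x t where "x + t = u" "x * t = p"
      by (rule sum_prod_complex)
    ultimately show "poly (poly L [:u:]) p = 0"
      using jet[of x t] by simp
  qed
  then show "- (27 * k0 ^ 2 + k0 ^ 3) = 0" "- (54 * k0 * k7 + 27 * k2 ^ 2 + k0 * k2 ^ 2 + 2 * k0 ^ 2 * k7) = 0"
    "- (27 * k7 ^ 2 + k0 * k7 ^ 2) = 0" "- (18 * k0 * k1 + 2 * k0 ^ 2 * k1) = 0"
    "- (18 * k0 * k5 + 18 * k1 * k2 + 2 * k0 * k1 * k2 + 2 * k0 ^ 2 * k5) = 0"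
    "18 * k0 * k2 - 3 * k1 ^ 2 - k0 * k1 ^ 2 - 2 * k0 ^ 2 * k4 = 0"
    "48 * k0 * k7 - 6 * k1 * k5 + 6 * k2 ^ 2 - 2 * k0 * k1 * k5 - 2 * k0 * k2 * k4 = 0"
    "18 * k2 * k7 - 3 * k5 ^ 2 - 2 * k0 * k4 * k7 - k0 * k5 ^ 2 = 0"
    "- 6 * k3 + 2 * k0 * k3 + 12 * k0 * k5 + 4 * k1 * k2 + 2 * k1 * k4 - 2 * k0 * k1 * k4 = 0"
    "- 6 * k8 + 2 * k0 * k8 + 8 * k1 * k7 + 6 * k2 * k5 + 2 * k4 * k5 - 2 * k0 * k4 * k5 = 0"
    "- 6 * k6 - 3 * k7 + 2 * k0 * k6 - 5 * k0 * k7 + 3 * k1 * k5 + k2 * k4 + 2 * k4 ^ 2 - k0 * k4 ^ 2 = 0"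
    by (simp_all only: L_def jet_poly_def pCons_eq_0_iff)
qed

lemma generically_associative_symmetric_cubic_poly_cases:
  fixes k0 k1 k2 k3 k4 k5 k6 k7 k8 k9 :: complex
  defines "k \<equiv> (\<lambda>i. [k0, k1, k2, k3, k4, k5, k6, k7, k8, k9] ! i)"
  assumes assoc: "generically_associative (symmetric_cubic_poly k)"
  obtains c where "k = elliptic_coeffs c" | \<alpha> where "k = cube_coeffs \<alpha>"
proof -
  note rel = associative_coefficient_relations[OF assoc[unfolded k_def]]
  note assoc_lead = associative_imp_resultant_symmetric(2)[OF assoc]
  have "k0 ^ 2 * (k0 + 27) = 0"
    using rel(1) by (simp only: neg_equal_0_iff_equal) (simp add: algebra_simps power2_eq_square power3_eq_cube)
  then have "k0 = 0 \<or> k0 = - 27"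
    by (simp add: eq_neg_iff_add_eq_0)
  then show thesis
  proof
    assume k0: "k0 = 0"
    with rel have "k1 = 0" "k2 = 0" "k7 = 0"
      by simp_all
    moreover from this k0 rel have "k3 = 0" "k5 = 0"
      by simp_all
    moreover from this calculation k0 rel have "k8 = 0"
      by simp
    moreover define \<alpha> where "\<alpha> = k4 / 3"
    then have k4: "k4 = 3 * \<alpha>"
      by auto
    moreover have k6: "k6 = 3 * \<alpha> ^ 2"
      using rel(11) k0 calculation by (simp add: power2_eq_square)
    moreover define q where "q = k9 - \<alpha> ^ 3"
    then have k9: "k9 = \<alpha> ^ 3 + q"
      by simp
    ultimately have L: "assoc_lead k = assoc_lead ((cube_coeffs \<alpha>)(9 := \<alpha> ^ 3 + q))"
      using k0 by (simp add: fun_eq_iff assoc_lead_def zcoeff_defs cube_coeffs_simps k_def flip: One_nat_def)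
    \<comment> \<open>The defect vanishes for every T, so it is zero as a polynomial in T; its
      coefficient of degree six then gives q = 0.\<close>
    have "0 = [:0, 0, 0, 0, 0, 0, 18 * q, 0, - 108 * \<alpha> * q, 0, 270 * \<alpha> ^ 2 * q, 0, - 360 * \<alpha> ^ 3 * q - 360 * q ^ 2,
        0, 1080 * \<alpha> * q ^ 2 + 270 * \<alpha> ^ 4 * q, 0, - 1080 * \<alpha> ^ 2 * q ^ 2 - 108 * \<alpha> ^ 5 * q, 0, 360 * \<alpha> ^ 3 * q ^ 2
        + 18 * \<alpha> ^ 6 * q + 342 * q ^ 3:]"
      by (rule poly_ext) (use assoc_lead_cube_coeffs_defect[of \<alpha> q] assoc_lead[unfolded L] in simp)
    then have "q = 0"
      by simp
    \<comment> \<open>Both sides index the same list, so the equality also covers indices beyond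
      9.\<close>
    then have "k = cube_coeffs \<alpha>"
      using k0 k4 k6 k9 \<open>k1 = 0\<close> \<open>k2 = 0\<close> \<open>k3 = 0\<close> \<open>k5 = 0\<close> \<open>k7 = 0\<close> \<open>k8 = 0\<close>
      by (simp add: k_def cube_coeffs_def fun_eq_iff)
    then show thesis by (rule that(2))
  next
    assume k0: "k0 = - 27"
    with rel(4) have k1: "k1 = 0"
      by simp
    with rel(5) k0 have k5: "k5 = 0"
      by simp
    define c where "c = k4 / 18"
    then have k4: "k4 = 18 * c"
      by auto
    have k2: "k2 = - (54 * c)"
      using rel(6) by (simp add: k0 k1 k4 minus_equation_iff[of k2])
    have k7: "k7 = - (27 * c ^ 2)"
    proof -
      \<comment> \<open>In terms of the deviation d from the expected value, the relation reduces to
        a nonzero multiple of d being zero.\<close>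
      define d where "d = k7 + 27 * c ^ 2"
      then have k7: "k7 = d - 27 * c ^ 2" by simp
      have "d = 0"
        using rel(7) by (simp add: k0 k1 k2 k4 k5 k7 algebra_simps power2_eq_square)
      then show ?thesis by (simp add: k7)
    qed
    have k6: "k6 = 81 * c ^ 2"
    proof -
      define d where "d = k6 - 81 * c ^ 2"
      then have k6: "k6 = d + 81 * c ^ 2" by simp
      have "d = 0"
        using rel(11) by (simp add: k0 k1 k2 k4 k5 k6 k7 algebra_simps power2_eq_square)
      then show ?thesis by (simp add: k6)
    qed
    have k3: "k3 = 0" and k8: "k8 = 0"
      using rel(9,10) by (simp_all add: k0 k1 k5)
    have L: "assoc_lead k = assoc_lead ((elliptic_coeffs c)(9 := k9))"
      by (simp add: fun_eq_iff assoc_lead_def zcoeff_defs elliptic_coeffs_simps k_def k0 k1 k2 k3 k4 k5 k6 k7 k8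
          flip: One_nat_def)
    \<comment> \<open>As in the first case, the coefficient of degree six, 504 k9, decides.\<close>
    have "0 = [:0, 0, 0, 0, 0, 0, 504 * k9, 0, - 7452 * c * k9, 0, - 343602 * c ^ 2 * k9, 0, - 34992 * c ^ 3 * k9
        + 21024 * k9 ^ 2, 0, - 65448 * c * k9 ^ 2 + 1482786 * c ^ 4 * k9, 0,
        178848 * c ^ 2 * k9 ^ 2 - 12045996 * c ^ 5 * k9, 0, - 262440 * c ^ 3 * k9 ^ 2 + 23422770 * c ^ 6 * k9
        + 342 * k9 ^ 3, 0, 104976 * c ^ 4 * k9 ^ 2 - 15588936 * c ^ 7 * k9, 0, 3188646 * c ^ 8 * k9:]"
      by (rule poly_ext) (use assoc_lead_elliptic_coeffs_defect[of c k9] assoc_lead[unfolded L] in simp)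
    then have "k9 = 0"
      by simp
    then have "k = elliptic_coeffs c"
      by (simp add: k_def elliptic_coeffs_def k0 k1 k2 k3 k4 k5 k6 k7 k8 fun_eq_iff)
    then show thesis by (rule that(1))
  qed
qed

lemma symmetric_algebraic_group_iff:
  "symmetric_algebraic_group 3 P \<longleftrightarrow> (\<exists>c. P = symmetric_cubic_poly (elliptic_coeffs c)) \<or> (\<exists>\<alpha>. P =
      symmetric_cubic_poly (cube_coeffs \<alpha>))"
proof
  assume P: "symmetric_algebraic_group 3 P"
  obtain k0 k1 k2 k3 k4 k5 k6 k7 k8 k9
    where k: "P = symmetric_cubic_poly (\<lambda>i. [k0, k1, k2, k3, k4, k5, k6, k7, k8, k9] ! i)"
    using P by (rule symmetric_algebraic_group_imp_symmetric_cubic_poly)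
  have "generically_associative P"
    using P by (simp add: symmetric_algebraic_group_def algebraic_group_def)
  then show "(\<exists>c. P = symmetric_cubic_poly (elliptic_coeffs c)) \<or> (\<exists>\<alpha>. P = symmetric_cubic_poly (cube_coeffs \<alpha>))"
    unfolding k by (rule generically_associative_symmetric_cubic_poly_cases) metis+
next
  assume "(\<exists>c. P = symmetric_cubic_poly (elliptic_coeffs c)) \<or> (\<exists>\<alpha>. P = symmetric_cubic_poly (cube_coeffs \<alpha>))"
  then show "symmetric_algebraic_group 3 P"
    using symmetric_algebraic_group_symmetric_cubic_poly generically_associative_elliptic_coeffs
        generically_associative_cube_coeffs by blast
qed

section \<open>The two families\<close>

text \<open>Negating x and y is an involution, so prescribing R is the same as prescribing
  P.\<close>

lemma subst3_neg_eq_iff: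
  assumes "\<And>a b c. eval3 id R a b c = symmetric_cubic k a b c"
  shows "subst3 P (- varx) (- vary) varz = R \<longleftrightarrow> P = symmetric_cubic_poly k"
proof
  assume R: "subst3 P (- varx) (- vary) varz = R"
  show "P = symmetric_cubic_poly k"
  proof (rule poly3_eqI)
    fix a b c
    show "eval3 id P a b c = eval3 id (symmetric_cubic_poly k) a b c"
      using arg_cong[OF R, of "\<lambda>R. eval3 id R (- a) (- b) c"] by (simp add: assms eval3_symmetric_cubic_poly)
  qed
next
  assume "P = symmetric_cubic_poly k"
  then show "subst3 P (- varx) (- vary) varz = R"
    by (intro poly3_eqI) (simp add: assms eval3_symmetric_cubic_poly ring_morphism.morphism_symmetric_cubic[OF
        ring_morphism_eval3[OF ring_morphism_id]])
qed

lemma subst3_neg_elliptic_coeffs_iff: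
  "subst3 P (- varx) (- vary) varz =
     sigma1 ^ 3 - 27 * sigma3 + const3 (18 * c) * sigma1 ^ 2 * sigma3
     - const3 (54 * c) * sigma2 * sigma3 - const3 (27 * c ^ 2) * sigma2 ^ 2 * sigma3
     + const3 (81 * c ^ 2) * sigma1 * sigma3 ^ 2 \<longleftrightarrow> P = symmetric_cubic_poly (elliptic_coeffs c)"
  by (rule subst3_neg_eq_iff)
     (simp add: sigma1_def sigma2_def sigma3_def symmetric_cubic_sigma elliptic_coeffs_simps Let_def algebra_simps
         power2_eq_square flip: One_nat_def)

lemma subst3_neg_elliptic_coeffs_0_iff: "subst3 P (- varx) (- vary) varz = sigma1 ^ 3 - 27 * sigma3 \<longleftrightarrow> P =
    symmetric_cubic_poly (elliptic_coeffs 0)"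
  by (rule subst3_neg_eq_iff)
     (simp add: sigma1_def sigma2_def sigma3_def symmetric_cubic_sigma elliptic_coeffs_simps Let_def flip:
         One_nat_def)

lemma subst3_neg_cube_coeffs_iff:
  "subst3 P (- varx) (- vary) varz = (sigma1 + const3 \<alpha> * sigma3) ^ 3 \<longleftrightarrow> P = symmetric_cubic_poly (cube_coeffs \<alpha>)"
proof (rule subst3_neg_eq_iff)
  fix a b c
  have "(s + \<alpha> * q) ^ 3 = s ^ 3 + q * (3 * \<alpha> * s ^ 2 + 3 * \<alpha> ^ 2 * s * q + \<alpha> ^ 3 * q ^ 2)" for s q
    by (simp add: algebra_simps power2_eq_square power3_eq_cube)
  then show "eval3 id ((sigma1 + const3 \<alpha> * sigma3) ^ 3) a b c = symmetric_cubic (cube_coeffs \<alpha>) a b c"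
    by (simp add: sigma1_def sigma3_def symmetric_cubic_sigma cube_coeffs_simps Let_def flip: One_nat_def)
qed

lemma subst3_neg_cube_coeffs_0_iff: "subst3 P (- varx) (- vary) varz = sigma1 ^ 3 \<longleftrightarrow> P =
    symmetric_cubic_poly (cube_coeffs 0)"
  using subst3_neg_cube_coeffs_iff[of P 0] by (simp add: const3_def)

section \<open>The coefficient of sigma_3 and the homogeneous component\<close>

lemma subst3_sigma_inject:
  assumes "subst3 Q sigma1 sigma2 sigma3 = subst3 Q' sigma1 sigma2 sigma3"
  shows "Q = Q'"
proof (rule poly3_eqI)
  fix a b c :: complex
  \<comment> \<open>Every triple (a, b, c) consists of the elementary symmetric functions of the
    roots of \<open>X^3 - a X^2 + b X - c\<close>, so equality on such triples is equality
    everywhere.\<close>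
  obtain u v w where "- c = - (1 * u * v * w)" "b = 1 * (u * v + v * w + u * w)" "- a = - (1 * (u + v + w))"
    by (rule cubic_splits[of "1 :: complex" "- c" b "- a"]) simp_all
  then have "c = u * v * w" "b = u * v + v * w + u * w" "a = u + v + w"
    by (simp_all only: mult_1 neg_equal_iff_equal)
  then show "eval3 id Q a b c = eval3 id Q' a b c"
    using arg_cong[OF assms, of "\<lambda>R. eval3 id R u v w"] by (simp add: sigma1_def sigma2_def sigma3_def)
qed

lemma sigma3_coeff_eqI:
  assumes "subst3 Q sigma1 sigma2 sigma3 = R" "coeff3 Q 0 0 1 = d"
  shows "sigma3_coeff R = d"
proof -
  have "(THE Q. subst3 Q sigma1 sigma2 sigma3 = R) = Q"
    using assms(1) subst3_sigma_inject by (intro the_equality) blast+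
  with assms(2) show ?thesis
    by (simp add: sigma3_coeff_def)
qed

lemma sigma3_coeff_elliptic_coeffs:
  "sigma3_coeff (sigma1 ^ 3 - 27 * sigma3 + const3 (18 * c) * sigma1 ^ 2 * sigma3
     - const3 (54 * c) * sigma2 * sigma3 - const3 (27 * c ^ 2) * sigma2 ^ 2 * sigma3
     + const3 (81 * c ^ 2) * sigma1 * sigma3 ^ 2) = - 27"
proof (rule sigma3_coeff_eqI)
  let ?Q = "varx ^ 3 - 27 * varz + const3 (18 * c) * varx ^ 2 * varz
     - const3 (54 * c) * vary * varz - const3 (27 * c ^ 2) * vary ^ 2 * varz
     + const3 (81 * c ^ 2) * varx * varz ^ 2"
  show "subst3 ?Q sigma1 sigma2 sigma3 = sigma1 ^ 3 - 27 * sigma3 + const3 (18 * c) * sigma1 ^ 2 * sigma3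
     - const3 (54 * c) * sigma2 * sigma3 - const3 (27 * c ^ 2) * sigma2 ^ 2 * sigma3
     + const3 (81 * c ^ 2) * sigma1 * sigma3 ^ 2"
    by simp
  show "coeff3 ?Q 0 0 1 = - 27"
    by (simp add: coeff3_def varx_def vary_def varz_def const3_def numeral_poly power2_eq_square power3_eq_cube)
qed

lemma sigma3_coeff_cube_coeffs: "sigma3_coeff ((sigma1 + const3 \<alpha> * sigma3) ^ 3) = 0"
proof (rule sigma3_coeff_eqI)
  show "subst3 ((varx + const3 \<alpha> * varz) ^ 3) sigma1 sigma2 sigma3 = (sigma1 + const3 \<alpha> * sigma3) ^ 3"
    by simp
  show "coeff3 ((varx + const3 \<alpha> * varz) ^ 3) 0 0 1 = 0"
    by (simp add: coeff3_def varx_def vary_def varz_def const3_def numeral_poly power2_eq_square power3_eq_cube)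
qed

lemma coeff3_monom3: "coeff3 (monom3 m a b c) i j l = (if (a, b, c) = (i, j, l) then m else 0)"
  by (cases "c = l"; cases "b = j") (simp_all add: coeff3_def monom3_def)

lemma coeff3_homogeneous_component:
  "coeff3 (homogeneous_component n P) i j l = (if i + j + l = n then coeff3 P i j l else 0)"
proof -
  let ?S = "{(i, j, k). i + j + k = n}"
  have "?S \<subseteq> {..n} \<times> {..n} \<times> {..n}"
    by auto
  then have fin: "finite ?S"
    by (rule finite_subset) auto
  have add: "coeff3 (P + Q) i j l = coeff3 P i j l + coeff3 Q i j l" for P Q
    by (simp add: coeff3_def)
  have "coeff3 (sum f A) i j l = (\<Sum>a\<in>A. coeff3 (f a) i j l)" for f and A :: "(nat \<times> nat \<times> nat) set"
    by (induction A rule: infinite_finite_induct) (simp_all add: add, simp_all add: coeff3_def)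
  then have "coeff3 (homogeneous_component n P) i j l =
      (\<Sum>a\<in>?S. coeff3 (case a of (i, j, k) \<Rightarrow> monom3 (coeff3 P i j k) i j k) i j l)"
    unfolding homogeneous_component_def by simp
  also have "\<dots> = (\<Sum>a\<in>?S. if a = (i, j, l) then coeff3 P i j l else 0)"
    by (rule sum.cong) (auto simp: coeff3_monom3 split: if_splits)
  also have "\<dots> = (if i + j + l = n then coeff3 P i j l else 0)"
    using fin by (simp add: sum.delta)
  finally show ?thesis .
qed

text \<open>In \<open>\<sigma>\<^sub>3 S\<close> only the constant term of S contributes to total
  degree three.\<close>

lemma homogeneous_component_symmetric_cubic_poly:
  "homogeneous_component 3 (symmetric_cubic_poly k) = symmetric_cubic_poly (\<lambda>i. if i = 0 then k 0 else 0)"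
proof (rule poly3_eqI_coeff)
  fix i j l
  let ?k = "\<lambda>i :: nat. if i = 0 then k 0 else 0"
  have "(if i + j + l = 3 then symmetric_cubic_coeff k i j l else 0) = symmetric_cubic_coeff ?k i j l" if "i \<le> 3"
      "j \<le> 3" "l \<le> 3"
  proof -
    from that have "i = 0 \<or> i = 1 \<or> i = 2 \<or> i = 3" "j = 0 \<or> j = 1 \<or> j = 2 \<or> j = 3"
      "l = 0 \<or> l = 1 \<or> l = 2 \<or> l = 3"
      by linarith+
    then show ?thesis
      by (elim disjE) (simp_all add: symmetric_cubic_coeff_def)
  qed
  then show "coeff3 (homogeneous_component 3 (symmetric_cubic_poly k)) i j l =
      coeff3 (symmetric_cubic_poly ?k) i j l"
    by (auto simp: coeff3_homogeneous_component symmetric_cubic_poly_box_poly coeff3_box_poly split: if_splits)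
qed

lemma homogeneous_component_families:
  "homogeneous_component 3 (symmetric_cubic_poly (elliptic_coeffs c)) = symmetric_cubic_poly (elliptic_coeffs 0)"
  "homogeneous_component 3 (symmetric_cubic_poly (cube_coeffs \<alpha>)) = symmetric_cubic_poly (cube_coeffs 0)"
  by (simp_all add: homogeneous_component_symmetric_cubic_poly)
      (simp_all add: symmetric_cubic_poly_def zcoeff_defs elliptic_coeffs_simps cube_coeffs_simps flip: One_nat_def)

section \<open>The 3-valued group G_3\<close>

lemma eval2_Fcoeff_0: "eval2 id (Fcoeff n Q 0) x y = Polynomial.coeff (zpoly id Q x y) n"
  by (simp add: Fcoeff_def zpoly_def coeff_map_poly)

lemma roots_G3:
  fixes a b e :: complex
  assumes e: "e ^ 2 = - 1 - e"
  shows "[:zcoeff0 (- (a ^ 3)) (- (b ^ 3)), zcoeff1 (elliptic_coeffs 0) (- (a ^ 3)) (- (b ^ 3)),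
      zcoeff2 (elliptic_coeffs 0) (- (a ^ 3)) (- (b ^ 3)), zcoeff3 (elliptic_coeffs 0) (- (a ^ 3)) (- (b ^ 3)):] =
    [:- ((a + e * b) ^ 3), 1:] * [:- ((a + e ^ 2 * b) ^ 3), 1:] * [:- ((a + b) ^ 3), 1:]"
proof -
  define A U V f where "A = a ^ 3 + b ^ 3" and "U = 3 * a ^ 2 * b" and "V = 3 * a * b ^ 2" and "f = e ^ 2"
  have ee: "e * e = f" and ef: "e + f = - 1"
    using e by (simp_all add: f_def power2_eq_square)
  have "e * f = - (e + e * e)"
    unfolding f_def by (subst e) (simp add: algebra_simps)
  then have ef1: "e * f = 1"
    by (simp only: ee ef) simp
  then have fe1: "f * e = 1"
    by (simp add: mult.commute)
  from ef1 have ff: "f * f = e"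
    by (metis ee mult.assoc mult.right_neutral)
  \<comment> \<open>For a cube root of unity g the last term vanishes, and the cube becomes A + g U
    + g^2 V. The sum and product of the values at e and f = e^2 then follow from e + f = -1 and e f
    = 1.\<close>
  have cube: "(a + g * b) ^ 3 = A + g * U + (g * g) * V + (g * g * g - 1) * b ^ 3" for g
    by (simp add: A_def U_def V_def algebra_simps power2_eq_square power3_eq_cube)
  have w: "(a + e * b) ^ 3 = A + e * U + f * V" "(a + e ^ 2 * b) ^ 3 = A + f * U + e * V" "(a + b) ^ 3 = A + U + V"
    using cube[of e] cube[of f] cube[of 1] by (simp_all add: ee ff ef1 fe1 f_def [symmetric])
  have "(A + e * U + f * V) + (A + f * U + e * V) = 2 * A + (e + f) * (U + V)"
    by (simp add: algebra_simps)
  then have s: "(A + e * U + f * V) + (A + f * U + e * V) = 2 * A - (U + V)"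
    by (simp add: ef)
  have "(A + e * U + f * V) * (A + f * U + e * V) =
      A ^ 2 + e * f * (U ^ 2 + V ^ 2) + (e + f) * A * (U + V) + (e * e + f * f) * U * V"
    by (simp add: algebra_simps power2_eq_square)
  then have p: "(A + e * U + f * V) * (A + f * U + e * V) = A ^ 2 + (U ^ 2 + V ^ 2) - A * (U + V) - U * V"
    using ef by (simp add: ef1 ee ff add.commute)
  have "[:- u, 1:] * [:- v, 1:] * [:- w, 1:] = [:- (u * v * w), u * v + (u + v) * w, - ((u + v) + w),
      1:]" for u v w :: complex
    by (simp add: algebra_simps)
  then show ?thesis
    unfolding w s p
    by (simp only: p s) (simp add: zcoeff_defs elliptic_coeffs_simps A_def U_def V_def algebra_simps
        power2_eq_square power3_eq_cube flip: One_nat_def)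
qed

lemma defines_G_elliptic_coeffs_0: "defines_G 3 (symmetric_cubic_poly (elliptic_coeffs 0))"
  unfolding defines_G_def
proof (intro conjI allI impI)
  show "algebraic_group 3 (symmetric_cubic_poly (elliptic_coeffs 0))"
    using symmetric_algebraic_group_iff symmetric_algebraic_group_def by blast
  fix x y :: complex
  have z: "zpoly id (symmetric_cubic_poly (elliptic_coeffs 0)) x y =
      [:zcoeff0 (- x) (- y), zcoeff1 (elliptic_coeffs 0) (- x) (- y), zcoeff2 (elliptic_coeffs 0) (- x) (- y),
      zcoeff3 (elliptic_coeffs 0) (- x) (- y):]"
    by (simp add: zpoly_symmetric_cubic_poly)
  have "eval2 id (Fcoeff 3 (symmetric_cubic_poly (elliptic_coeffs 0)) 0) x y =
      Polynomial.coeff (zpoly id (symmetric_cubic_poly (elliptic_coeffs 0)) x y) 3"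
    by (rule eval2_Fcoeff_0)
  also have "\<dots> = 1"
    unfolding z by (simp add: coeff_4 zcoeff3_def elliptic_coeffs_simps flip: One_nat_def)
  finally show "eval2 id (Fcoeff 3 (symmetric_cubic_poly (elliptic_coeffs 0)) 0) x y \<noteq> 0"
    by simp
  fix a b e :: complex
  assume *: "a ^ 3 = x \<and> b ^ 3 = y \<and> primitive_root_of_unity 3 e"
  then have e3: "e ^ 3 = 1" and "e ^ 1 \<noteq> 1"
    by (auto simp only: primitive_root_of_unity_def)
  then have "(e - 1) * (e ^ 2 + e + 1) = 0" "e - 1 \<noteq> 0"
    by (simp_all add: algebra_simps power2_eq_square power3_eq_cube)
  then have "e ^ 2 + e + 1 = 0"
    by simp
  then have e2: "e ^ 2 = - 1 - e"
    by (simp add: eq_diff_eq eq_neg_iff_add_eq_0)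
  have "mset_set {1..3 :: nat} = {#1, 2, 3#}"
    by (simp add: numeral_3_eq_3 numeral_2_eq_2 atLeastAtMostSuc_conv)
  moreover have "zpoly id (symmetric_cubic_poly (elliptic_coeffs 0)) x y =
      [:- ((a + e * b) ^ 3), 1:] * [:- ((a + e ^ 2 * b) ^ 3), 1:] * [:- ((a + b) ^ 3), 1:]"
    unfolding z using roots_G3[OF e2, of a b] * by simp
  ultimately show "mult_prod id (symmetric_cubic_poly (elliptic_coeffs 0)) x y =
      {#(a + e ^ r * b) ^ 3. r \<in># mset_set {1..3}#}"
    by (simp add: mult_prod_def proots_mult e3 del: mult_pCons_left mult_pCons_right)
qed

section \<open>The diagonal construction\<close>

definition tanh_poly :: "complex \<Rightarrow> poly3" where
  "tanh_poly \<alpha> = (1 + const3 \<alpha> * varx * vary) * varz - varx - vary"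

lemma tanh_poly_pCons: "tanh_poly \<alpha> = [:- [:0, 1:] - [:[:0, 1:]:], 1 + [:[:\<alpha>:]:] * [:[:0, 1:]:] * [:0, 1:]:]"
  by (simp add: tanh_poly_def const3_def varx_def vary_def varz_def one_pCons)

lemma zpoly_tanh_poly:
  assumes "ring_morphism h"
  shows "zpoly h (tanh_poly \<alpha>) x y = [:- (x + y), 1 + h \<alpha> * x * y:]"
  using assms unfolding tanh_poly_pCons zpoly_def
  by (simp add: map_poly_pCons del: mult_pCons_left mult_pCons_right minus_pCons diff_pCons add_pCons)

lemma subst3_tanh_poly: "subst3 (tanh_poly \<alpha>) (- varx) (- vary) varz = sigma1 + const3 \<alpha> * sigma3"
  by (simp add: tanh_poly_def sigma1_def sigma3_def algebra_simps)

lemma mult_prod_tanh_poly: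
  assumes "ring_morphism h" "1 + h \<alpha> * x * y \<noteq> (0 :: 'a::field)"
  shows "mult_prod h (tanh_poly \<alpha>) x y = {#(x + y) / (1 + h \<alpha> * x * y)#}"
proof -
  have "zpoly h (tanh_poly \<alpha>) x y = Polynomial.smult (1 + h \<alpha> * x * y) [:- ((x + y) / (1 + h \<alpha> * x * y)), 1:]"
    using assms by (simp add: zpoly_tanh_poly divide_simps)
  then show ?thesis
    by (simp only: mult_prod_def proots_smult[OF assms(2)]) simp
qed

text \<open>For \<alpha> = 1 the operation is the addition law of tanh. Both bracketings reduce to
  the same fraction N / D, whose numerator and denominator are symmetric in x, y, z.\<close>

lemma generically_associative_tanh_poly: "generically_associative (tanh_poly \<alpha>)"
proof -
  define x y z A where xyz: "x = gen varx" "y = gen vary" "z = gen varz" "A = gen (const3 \<alpha>)"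
  have prod: "gen_prod (tanh_poly \<alpha>) u v = {#(u + v) / (1 + A * u * v)#}" if "1 + A * u * v \<noteq> 0" for u v
    unfolding gen_prod_def using mult_prod_tanh_poly[OF ring_morphism_gen_const3, of \<alpha> u v] that by (simp add: xyz)
  have nz: "1 + A * x * y \<noteq> 0" "1 + A * y * z \<noteq> 0" "1 + A * x * y + A * (x + y) * z \<noteq> 0"
    using generic_value_nonzero[of "1 + const3 \<alpha> * varx * vary" 0 0 0] generic_value_nonzero[of "1
        + const3 \<alpha> * vary * varz" 0 0 0]
      generic_value_nonzero[of "1 + const3 \<alpha> * varx * vary + const3 \<alpha> * (varx + vary) * varz" 0 0 0]
    by (simp_all add: xyz gen.add gen.mult gen.one)
  define d e D N where "d = 1 + A * x * y" and "e = 1 + A * y * z"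
    and "D = d + A * (x + y) * z" and "N = x + y + z + A * x * y * z"
  have nz': "d \<noteq> 0" "e \<noteq> 0" "D \<noteq> 0"
    using nz by (simp_all add: d_def e_def D_def)
  have D: "D = e + A * x * (y + z)" and N: "N = (x + y) + z * d" "N = x * e + (y + z)"
    by (simp_all add: D_def N_def d_def e_def algebra_simps)
  let ?p = "(x + y) / d" and ?q = "(y + z) / e"
  have p: "1 + A * ?p * z = D / d" "?p + z = N / d"
    using nz' by (simp_all add: D_def N(1) add_divide_distrib[of d "A * (x + y) * z" d] add_divide_distrib[of "x
        + y" "z * d" d])
  have q: "1 + A * x * ?q = D / e" "x + ?q = N / e"
    using nz' by (simp_all add: D N(2) add_divide_distrib[of e "A * x * (y + z)" e] add_divide_distrib[of "x * e"
        "y + z" e])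
  have "(?p + z) / (1 + A * ?p * z) = (x + ?q) / (1 + A * x * ?q)"
    unfolding p q using nz' by simp
  moreover have "1 + A * ?p * z \<noteq> 0" "1 + A * x * ?q \<noteq> 0"
    unfolding p q using nz' by simp_all
  ultimately show ?thesis
    unfolding generically_associative_def xyz(1-3)[symmetric]
    using nz' by (simp add: prod d_def e_def)
qed

lemma algebraic_group_tanh_poly: "algebraic_group 1 (tanh_poly \<alpha>)"
proof -
  have F0: "eval2 h (Fcoeff 1 (tanh_poly \<alpha>) 0) x y = 1 + h \<alpha> * x * y"
    and F1: "eval2 h (Fcoeff 1 (tanh_poly \<alpha>) 1) x y = - (x + y)" if "ring_morphism h" for h x y
    using zpoly_tanh_poly[OF that, of \<alpha> x y, THEN arg_cong, of "\<lambda>p. Polynomial.coeff p 1"]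
      zpoly_tanh_poly[OF that, of \<alpha> x y, THEN arg_cong, of "\<lambda>p. Polynomial.coeff p 0"] that
    by (simp_all add: Fcoeff_def zpoly_def coeff_map_poly)
  have "tanh_poly \<alpha> = [:[:[:0, - 1:], [:- 1:]:], [:1, [:0, \<alpha>:]:]:]"
    by (simp add: tanh_poly_pCons one_pCons)
  then have "coeff3 (tanh_poly \<alpha>) i j k \<noteq> 0 \<longrightarrow> i \<le> 1 \<and> j \<le> 1 \<and> k \<le> 1" for i j k
    by (auto simp: coeff3_def coeff_pCons one_pCons split: nat.splits)
  moreover have "\<exists>q. \<forall>x. eval2 id (Fcoeff 1 (tanh_poly \<alpha>) 1) x (poly q x) = 0 \<and>
      eval2 id (Fcoeff 1 (tanh_poly \<alpha>) 1) (poly q x) x = 0"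
    by (rule exI[of _ "[:0, - 1:]"]) (simp add: F1 del: One_nat_def)
  moreover have "subst3 (tanh_poly \<alpha>) 0 vary varz =
      eval2 const3 (Fcoeff 1 (tanh_poly \<alpha>) 0) 0 vary * (varz - vary) ^ 1"
    by (simp add: F0 del: One_nat_def) (simp add: tanh_poly_def)
  ultimately show ?thesis
    unfolding algebraic_group_def using generically_associative_tanh_poly by (auto simp: F0 simp del: One_nat_def)
qed

lemma zpoly_cube_coeffs: "zpoly id (symmetric_cubic_poly (cube_coeffs \<alpha>)) x y = zpoly id (tanh_poly \<alpha>) x y ^ 3"
proof (rule poly_ext)
  fix z
  have "poly (zpoly id (symmetric_cubic_poly (cube_coeffs \<alpha>)) x y) z =
      symmetric_cubic (cube_coeffs \<alpha>) (- x) (- y) z"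
    using eval3_symmetric_cubic_poly[OF ring_morphism_id, of "cube_coeffs \<alpha>" x y z] by (simp add: eval3_def)
  also have "\<dots> = (z - x - y + \<alpha> * (x * y * z)) ^ 3"
    by (simp add: symmetric_cubic_sigma cube_coeffs_simps Let_def algebra_simps power2_eq_square power3_eq_cube
        flip: One_nat_def)
  also have "\<dots> = poly (zpoly id (tanh_poly \<alpha>) x y ^ 3) z"
    by (simp add: zpoly_tanh_poly algebra_simps)
  finally show "poly (zpoly id (symmetric_cubic_poly (cube_coeffs \<alpha>)) x y) z =
      poly (zpoly id (tanh_poly \<alpha>) x y ^ 3) z" .
qed

lemma diagonal_of_tanh_poly: "diagonal_of 3 1 (tanh_poly \<alpha>) (symmetric_cubic_poly (cube_coeffs \<alpha>))"
proof -
  have "eval2 id (Fcoeff (3 * 1) (symmetric_cubic_poly (cube_coeffs \<alpha>)) 0) x y =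
      eval2 id (Fcoeff 1 (tanh_poly \<alpha>) 0) x y ^ 3" for x y
    unfolding eval2_Fcoeff_0 by (simp add: zpoly_cube_coeffs zpoly_tanh_poly coeff_4 power3_eq_cube numeral_3_eq_3)
  then show ?thesis
    by (simp add: diagonal_of_def mult_prod_def zpoly_cube_coeffs proots_power)
qed

theorem theorem2:
  fixes P :: "complex poly poly poly"
  shows "(symmetric_algebraic_group 3 P \<longleftrightarrow>
      (sigma3_coeff (subst3 P (- varx) (- vary) varz) = - 27 \<and>
        (\<exists>c. subst3 P (- varx) (- vary) varz =
           sigma1 ^ 3 - 27 * sigma3 + const3 (18 * c) * sigma1 ^ 2 * sigma3
           - const3 (54 * c) * sigma2 * sigma3 - const3 (27 * c ^ 2) * sigma2 ^ 2 * sigma3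
           + const3 (81 * c ^ 2) * sigma1 * sigma3 ^ 2)) \<or>
      (sigma3_coeff (subst3 P (- varx) (- vary) varz) = 0 \<and>
        (\<exists>\<alpha>. subst3 P (- varx) (- vary) varz = (sigma1 + const3 \<alpha> * sigma3) ^ 3)))
    \<and>
    (\<forall>c. subst3 P (- varx) (- vary) varz =
           sigma1 ^ 3 - 27 * sigma3 + const3 (18 * c) * sigma1 ^ 2 * sigma3
           - const3 (54 * c) * sigma2 * sigma3 - const3 (27 * c ^ 2) * sigma2 ^ 2 * sigma3
           + const3 (81 * c ^ 2) * sigma1 * sigma3 ^ 2 \<longrightarrow>
       subst3 (homogeneous_component 3 P) (- varx) (- vary) varz = sigma1 ^ 3 - 27 * sigma3 \<and>
       defines_G 3 (homogeneous_component 3 P))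
    \<and>
    (\<forall>\<alpha>. subst3 P (- varx) (- vary) varz = (sigma1 + const3 \<alpha> * sigma3) ^ 3 \<longrightarrow>
       subst3 (homogeneous_component 3 P) (- varx) (- vary) varz = sigma1 ^ 3 \<and>
       (\<exists>P1. subst3 P1 (- varx) (- vary) varz = sigma1 + const3 \<alpha> * sigma3 \<and>
          algebraic_group 1 P1 \<and>
          (\<forall>x y. (eval2 id (Fcoeff 1 P1 0) x y \<noteq> 0 \<longleftrightarrow> 1 + \<alpha> * x * y \<noteq> 0) \<and>
             (1 + \<alpha> * x * y \<noteq> 0 \<longrightarrow>
                mult_prod id P1 x y = {#(x + y) / (1 + \<alpha> * x * y)#})) \<and>
          diagonal_of 3 1 P1 P))"
proof -
  define R where "R = subst3 P (- varx) (- vary) varz"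
  have iff: "symmetric_algebraic_group 3 P \<longleftrightarrow>
      (sigma3_coeff R = - 27 \<and>
        (\<exists>c. R = sigma1 ^ 3 - 27 * sigma3 + const3 (18 * c) * sigma1 ^ 2 * sigma3
           - const3 (54 * c) * sigma2 * sigma3 - const3 (27 * c ^ 2) * sigma2 ^ 2 * sigma3
           + const3 (81 * c ^ 2) * sigma1 * sigma3 ^ 2)) \<or>
      (sigma3_coeff R = 0 \<and> (\<exists>\<alpha>. R = (sigma1 + const3 \<alpha> * sigma3) ^ 3))"
    \<comment> \<open>On each family the value of \<open>sigma3_coeff\<close> has been computed, so
      it can be attached to the existential statement.\<close>
    unfolding symmetric_algebraic_group_iff R_def
      subst3_neg_elliptic_coeffs_iff [symmetric] subst3_neg_cube_coeffs_iff [symmetric]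
    using sigma3_coeff_elliptic_coeffs sigma3_coeff_cube_coeffs by metis
  have diagonal: "\<exists>P1. subst3 P1 (- varx) (- vary) varz = sigma1 + const3 \<alpha> * sigma3 \<and>
      algebraic_group 1 P1 \<and>
      (\<forall>x y. (eval2 id (Fcoeff 1 P1 0) x y \<noteq> 0 \<longleftrightarrow> 1 + \<alpha> * x * y \<noteq> 0) \<and>
         (1 + \<alpha> * x * y \<noteq> 0 \<longrightarrow> mult_prod id P1 x y = {#(x + y) / (1 + \<alpha> * x * y)#})) \<and>
      diagonal_of 3 1 P1 (symmetric_cubic_poly (cube_coeffs \<alpha>))" for \<alpha>
  \<comment> \<open>The witness is \<open>tanh_poly \<alpha>\<close>.\<close>
  proof (intro exI conjI allI impI)
    show "eval2 id (Fcoeff 1 (tanh_poly \<alpha>) 0) x y \<noteq> 0 \<longleftrightarrow> 1 + \<alpha> * x * y \<noteq> 0" for x y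
      by (simp add: eval2_Fcoeff_0 zpoly_tanh_poly)
    show "mult_prod id (tanh_poly \<alpha>) x y = {#(x + y) / (1 + \<alpha> * x * y)#}" if "1 + \<alpha> * x * y \<noteq> 0" for x y
      using mult_prod_tanh_poly[OF ring_morphism_id, of \<alpha> x y] that by simp
  qed (fact subst3_tanh_poly algebraic_group_tanh_poly diagonal_of_tanh_poly)+
  show ?thesis
  proof (intro conjI allI impI, goal_cases)
    case 1
    show ?case by (fact iff[unfolded R_def])
  next
    case (2 c)
    then show ?case
      by (simp only: subst3_neg_elliptic_coeffs_iff subst3_neg_elliptic_coeffs_0_iff homogeneous_component_families)
  next
    case (3 c)
    then show ?case
      by (simp only: subst3_neg_elliptic_coeffs_iff homogeneous_component_families defines_G_elliptic_coeffs_0)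
  next
    case (4 \<alpha>)
    then show ?case
      by (simp only: subst3_neg_cube_coeffs_iff subst3_neg_cube_coeffs_0_iff homogeneous_component_families)
  next
    case (5 \<alpha>)
    then have "P = symmetric_cubic_poly (cube_coeffs \<alpha>)"
      by (simp only: subst3_neg_cube_coeffs_iff)
    with diagonal[of \<alpha>] show ?case by simp
  qed
qed

end
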